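(* Let $R$ be a pmp equivalence relation on a standard probability space $(X,\mu)$, and let $E$ and $F$ be finite dynamical generating sets for $R$. Then $s(E)=s(F)$, $\underline{s}(E)=\underline{s}(F)$, and $s_\omega(E)=s_\omega(F)$ for every nonprincipal ultrafilter $\omega$ on $\mathbb N$.
   Context: Let $(X,\mu)$ be a standard probability space and $R\subseteq X\times X$ a countable Borel equivalence relation preserving $\mu$ (a pmp equivalence relation). $\llbracket R\rrbracket$ denotes the set of partial Borel bijections $s:\operatorname{dom}s\to\operatorname{ran}s$ between Borel subsets of $X$ with $(x,s(x))\in R$ for all $x\in\operatorname{dom}s$, identified when they agree off a null set; measure preservation means $\mu(\operatorname{dom}s)=\mu(\operatorname{ran}s)$. The product $st$ is $(st)(x)=s(t(x))$ on $\operatorname{dom}(st)=t^{-1}(\operatorname{ran}t\cap\operatorname{dom}s)$; $s^{-1}$ is the inverse map; $1$ is the identity of $X$ and $0$ the empty map. Elements $s_1,\dots,s_k$ are pairwise orthogonal if their domains are pairwise disjoint and their ranges are pairwise disjoint; their sum $\sum_i s_i$ is the element equal to $s_i$ on $\operatorname{dom}s_i$. For $F\subseteq\llbracket R\rrbracket$, $\mathbf\Sigma F$ is the set of all finite sums of pairwise orthogonal elements of $F$, $F_\pm=F\cup\{s^{-1}:s\in F\}\cup\{1\}$, and $F_\pm^n$ is the set of products of $n$ elements of $F_\pm$. The uniform distance is $|s-t|=\mu\{x\in\operatorname{dom}s\cup\operatorname{dom}t: s(x)\neq t(x)\}$, where by convention $s(x)\neq t(x)$ whenever $x\in\operatorname{dom}s\,\triangle\,\operatorname{dom}t$;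 the trace is $\tau(s)=\mu\{x\in\operatorname{dom}s: s(x)=x\}$. For $d\in\mathbb N$, $\llbracket d\rrbracket$ is the same structure for the full equivalence relation on $\{1,\dots,d\}$ with the uniform probability measure (partial permutations), with distance $|\cdot|$ and trace $\operatorname{tr}(\sigma)=\frac1d\#\{i\in\operatorname{dom}\sigma:\sigma(i)=i\}$. Microstates: for finite $F\subseteq\llbracket R\rrbracket$, $n,d\in\mathbb N$, $\delta>0$, ${\rm SA}(F,n,\delta,d)$ is the set of maps $\varphi:\llbracket R\rrbracket\to\llbracket d\rrbracket$ with $\varphi(1)=1$ such that $|\varphi(st)-\varphi(s)\varphi(t)|<\delta$ for all $s,t\in\mathbf\Sigma F_\pm^n$ with $st\in\mathbf\Sigma F_\pm^n$, and $|\operatorname{tr}(\varphi(s))-\tau(s)|<\delta$ for all $s\in\mathbf\Sigma F_\pm^n$. ${\rm NSA}(F,n,\delta,d)$ is the number of distinct restrictions $\varphi|_F$ with $\varphi\in{\rm SA}(F,n,\delta,d)$. Set $s(F,n,\delta)=\limsup_{d\to\infty}\frac{1}{d\log d}\log{\rm NSA}(F,n,\delta,d)$ (with $\log 0=-\infty$), $s(F,n)=\inf_{\delta>0}s(F,n,\delta)$, $s(F)=\inf_{n\in\mathbb N}s(F,n)$. $\underline s(F)$ is defined the same way with $\liminf_{d\to\infty}$, and for a nonprincipal ultrafilter $\omega$ on $\mathbb N$, $s_\omega(F)$ with $\lim_{d\to\omega}$. A set $F\subseteq\llbracket R\rrbracket$ is a dynamical generating set for $R$ if for every $t\in\llbracket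 R\rrbracket$ and $\varepsilon>0$ there are $n\in\mathbb N$ and $s\in\mathbf\Sigma F_\pm^n$ with $|t-s|<\varepsilon$. *)

theory Defs
  imports "HOL-Probability.Probability"
begin

text \<open>Elements of the pseudo full group are represented by partial maps
  (type 'a option-valued functions); the identification modulo null sets is
  handled by the a.e.-closure below and by requiring microstates to respect
  a.e.-equality.\<close>

definition pbij :: "'a measure \<Rightarrow> ('a \<times> 'a) set \<Rightarrow> ('a \<rightharpoonup> 'a) \<Rightarrow> bool" where
  "pbij M R s \<longleftrightarrow> dom s \<in> sets M \<and> ran s \<in> sets M \<and> inj_on s (dom s) \<and>
     (\<forall>x y. s x = Some y \<longrightarrow> (x, y) \<in> R) \<and>
     (\<forall>A\<in>sets M. {x. \<exists>y\<in>A. s x = Some y} \<in> sets M \<and> {y. \<exists>x\<in>A. s x = Some y} \<in> sets M)"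

definition cber :: "'a measure \<Rightarrow> ('a \<times> 'a) set \<Rightarrow> bool" where
  "cber M R \<longleftrightarrow> R \<in> sets (M \<Otimes>\<^sub>M M) \<and> equiv (space M) R \<and> (\<forall>x\<in>space M. countable (R `` {x}))"

definition pmp_rel :: "'a measure \<Rightarrow> ('a \<times> 'a) set \<Rightarrow> bool" where
  "pmp_rel M R \<longleftrightarrow> (\<forall>s. pbij M R s \<longrightarrow> emeasure M (dom s) = emeasure M (ran s))"

definition pinv :: "('a \<rightharpoonup> 'a) \<Rightarrow> ('a \<rightharpoonup> 'a)" where
  "pinv s = (\<lambda>y. if y \<in> ran s then Some (THE x. s x = Some y) else None)"

definition pid :: "'a measure \<Rightarrow> ('a \<rightharpoonup> 'a)" where
  "pid M = (\<lambda>x. if x \<in> space M then Some x else None)"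

definition udist :: "'a measure \<Rightarrow> ('a \<rightharpoonup> 'a) \<Rightarrow> ('a \<rightharpoonup> 'a) \<Rightarrow> real" where
  "udist M s t = measure M {x. s x \<noteq> t x}"

definition trace :: "'a measure \<Rightarrow> ('a \<rightharpoonup> 'a) \<Rightarrow> real" where
  "trace M s = measure M {x. s x = Some x}"

definition orth :: "('a \<rightharpoonup> 'a) \<Rightarrow> ('a \<rightharpoonup> 'a) \<Rightarrow> bool" where
  "orth s t \<longleftrightarrow> dom s \<inter> dom t = {} \<and> ran s \<inter> ran t = {}"

definition osums :: "('a \<rightharpoonup> 'a) set \<Rightarrow> ('a \<rightharpoonup> 'a) set" where
  "osums S = {foldr (\<lambda>s acc. s ++ acc) ss Map.empty | ss.
      set ss \<subseteq> S \<and> (\<forall>i<length ss. \<forall>j<length ss. i \<noteq> j \<longrightarrow> orth (ss ! i) (ss ! j))}"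

definition aeclose :: "'a measure \<Rightarrow> ('a \<times> 'a) set \<Rightarrow> ('a \<rightharpoonup> 'a) set \<Rightarrow> ('a \<rightharpoonup> 'a) set" where
  "aeclose M R S = {s. pbij M R s \<and> (\<exists>t\<in>S. AE x in M. s x = t x)}"

definition Fpm :: "'a measure \<Rightarrow> ('a \<rightharpoonup> 'a) set \<Rightarrow> ('a \<rightharpoonup> 'a) set" where
  "Fpm M F = F \<union> pinv ` F \<union> {pid M}"

primrec prods :: "'a measure \<Rightarrow> ('a \<rightharpoonup> 'a) set \<Rightarrow> nat \<Rightarrow> ('a \<rightharpoonup> 'a) set" where
  "prods M S 0 = {pid M}"
| "prods M S (Suc n) = {s \<circ>\<^sub>m t | s t. s \<in> S \<and> t \<in> prods M S n}"

definition SigmaPow :: "'a measure \<Rightarrow> ('a \<times> 'a) set \<Rightarrow> ('a \<rightharpoonup> 'a) set \<Rightarrow> nat \<Rightarrow> ('a \<rightharpoonup> 'a) set" where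
  "SigmaPow M R F n = aeclose M R (osums (aeclose M R (prods M (Fpm M F) n)))"

definition dyn_gen :: "'a measure \<Rightarrow> ('a \<times> 'a) set \<Rightarrow> ('a \<rightharpoonup> 'a) set \<Rightarrow> bool" where
  "dyn_gen M R F \<longleftrightarrow> F \<subseteq> {s. pbij M R s} \<and>
     (\<forall>t. pbij M R t \<longrightarrow> (\<forall>\<epsilon>>0. \<exists>n s. s \<in> SigmaPow M R F n \<and> udist M t s < \<epsilon>))"

definition pperm :: "nat \<Rightarrow> (nat \<rightharpoonup> nat) \<Rightarrow> bool" where
  "pperm d \<sigma> \<longleftrightarrow> dom \<sigma> \<subseteq> {1..d} \<and> ran \<sigma> \<subseteq> {1..d} \<and> inj_on \<sigma> (dom \<sigma>)"

definition pid_d :: "nat \<Rightarrow> (nat \<rightharpoonup> nat)" where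
  "pid_d d = (\<lambda>i. if i \<in> {1..d} then Some i else None)"

definition udist_d :: "nat \<Rightarrow> (nat \<rightharpoonup> nat) \<Rightarrow> (nat \<rightharpoonup> nat) \<Rightarrow> real" where
  "udist_d d \<sigma> \<rho> = real (card {i\<in>{1..d}. \<sigma> i \<noteq> \<rho> i}) / real d"

definition tr_d :: "nat \<Rightarrow> (nat \<rightharpoonup> nat) \<Rightarrow> real" where
  "tr_d d \<sigma> = real (card {i\<in>{1..d}. \<sigma> i = Some i}) / real d"

text \<open>Microstates: maps on the pseudo full group (represented on representatives,
  respecting a.e.-equality, and fixed to the empty map off the pseudo full group).\<close>
definition SA :: "'a measure \<Rightarrow> ('a \<times> 'a) set \<Rightarrow> ('a \<rightharpoonup> 'a) set \<Rightarrow> nat \<Rightarrow> real \<Rightarrow> nat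
    \<Rightarrow> (('a \<rightharpoonup> 'a) \<Rightarrow> (nat \<rightharpoonup> nat)) set" where
  "SA M R F n \<delta> d = {\<phi>.
     (\<forall>s. pbij M R s \<longrightarrow> pperm d (\<phi> s)) \<and>
     (\<forall>s. \<not> pbij M R s \<longrightarrow> \<phi> s = Map.empty) \<and>
     (\<forall>s t. pbij M R s \<and> pbij M R t \<and> (AE x in M. s x = t x) \<longrightarrow> \<phi> s = \<phi> t) \<and>
     \<phi> (pid M) = pid_d d \<and>
     (\<forall>s\<in>SigmaPow M R F n. \<forall>t\<in>SigmaPow M R F n. s \<circ>\<^sub>m t \<in> SigmaPow M R F n \<longrightarrow>
        udist_d d (\<phi> (s \<circ>\<^sub>m t)) (\<phi> s \<circ>\<^sub>m \<phi> t) < \<delta>) \<and>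
     (\<forall>s\<in>SigmaPow M R F n. \<bar>tr_d d (\<phi> s) - trace M s\<bar> < \<delta>)}"

definition NSA :: "'a measure \<Rightarrow> ('a \<times> 'a) set \<Rightarrow> ('a \<rightharpoonup> 'a) set \<Rightarrow> nat \<Rightarrow> real \<Rightarrow> nat \<Rightarrow> nat" where
  "NSA M R F n \<delta> d = card ((\<lambda>\<phi>. restrict \<phi> F) ` SA M R F n \<delta> d)"

definition ent_seq :: "'a measure \<Rightarrow> ('a \<times> 'a) set \<Rightarrow> ('a \<rightharpoonup> 'a) set \<Rightarrow> nat \<Rightarrow> real \<Rightarrow> nat \<Rightarrow> ereal" where
  "ent_seq M R F n \<delta> d =
     (if NSA M R F n \<delta> d = 0 then -\<infinity>
      else ereal (ln (real (NSA M R F n \<delta> d)) / (real d * ln (real d))))"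

definition s_ent :: "'a measure \<Rightarrow> ('a \<times> 'a) set \<Rightarrow> ('a \<rightharpoonup> 'a) set \<Rightarrow> ereal" where
  "s_ent M R F = (INF n. INF \<delta>\<in>{0<..}. limsup (ent_seq M R F n \<delta>))"

definition s_ent_low :: "'a measure \<Rightarrow> ('a \<times> 'a) set \<Rightarrow> ('a \<rightharpoonup> 'a) set \<Rightarrow> ereal" where
  "s_ent_low M R F = (INF n. INF \<delta>\<in>{0<..}. liminf (ent_seq M R F n \<delta>))"

definition s_ent_omega :: "nat filter \<Rightarrow> 'a measure \<Rightarrow> ('a \<times> 'a) set \<Rightarrow> ('a \<rightharpoonup> 'a) set \<Rightarrow> ereal" where
  "s_ent_omega \<omega> M R F = (INF n. INF \<delta>\<in>{0<..}. Lim \<omega> (ent_seq M R F n \<delta>))"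

definition nonprincipal_ultrafilter :: "nat filter \<Rightarrow> bool" where
  "nonprincipal_ultrafilter \<omega> \<longleftrightarrow> \<omega> \<noteq> bot \<and>
     (\<forall>P. eventually P \<omega> \<or> eventually (\<lambda>x. \<not> P x) \<omega>) \<and> \<omega> \<le> cofinite"

end

theory Submission
  imports Defs "HOL-Real_Asymp.Real_Asymp"
begin

text \<open>
  A microstate \<open>\<phi>\<close> is approximately Lipschitz on \<open>SigmaPow M R F m\<close>: the uniform distance of \<open>a\<close>
  and \<open>b\<close> is a combination of traces of words in \<open>a\<close>, \<open>b\<close> and their inverses, and \<open>\<phi>\<close>
  approximately preserves products and traces. Likewise \<open>\<phi>\<close> is determined on every orthogonal sum of
  words, up to a constant times \<open>\<delta>\<close>, by its restriction to \<open>F\<close>.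

  Modulo null sets \<open>SigmaPow M R F N\<close> is finite, so all its elements are approximated by elements of
  one \<open>SigmaPow M R E m\<close>. Composing a fine microstate for \<open>E\<close> with this approximation gives a
  microstate \<open>\<psi>\<close> for \<open>F\<close>. As \<open>F\<close> generates, the elements of \<open>E\<close> are close to
  orthogonal sums of words in \<open>F\<close>, so the restriction of \<open>\<psi>\<close> to \<open>F\<close> recovers the original
  microstate on \<open>E\<close> up to normalised Hamming distance \<open>\<eta>\<close>. A Hamming ball of that radius has at
  most \<open>2 ^ d * (d + 1) ^ (\<eta> * d)\<close> elements, which costs only about \<open>\<eta>\<close> per element of \<open>E\<close> on
  the scale \<open>d * ln d\<close>.
\<close>

section \<open>Partial bijections\<close>

text \<open>\<open>SA\<close> constrains a microstate only through products and traces. Inverses,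
  orthogonal sums and distances do not occur there and have to be recovered. The lever is
  injectivity of the values: an injective \<open>P\<close> with \<open>PP = P\<close> at a point
  fixes that point or is undefined there. Hence \<open>\<phi> (pinv s \<circ>\<^sub>m s)\<close> is
  nearly a partial identity whose size is a trace, and this controls the size of the domain of
  \<open>\<phi> s\<close>. Two maps of the right size with a common approximate inverse must then
  agree at most points. A sum \<open>u = s ++ t\<close> is tied to its parts by
  \<open>s = up\<close> and \<open>t = uq\<close>, where \<open>p\<close> and \<open>q\<close> are
  the projections onto the two domains and \<open>pq\<close> is empty. All estimates are linear in
  \<delta>, with constants independent of \<open>d\<close>. So the parameters can be fixed in this
  order: the level and constant for approximating \<open>E\<close> by \<open>F\<close>, the
  tolerance for \<open>F\<close>, then \<epsilon> and \<delta>, and only then the level for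
  approximating \<open>F\<close> by \<open>E\<close>.\<close>

lemma map_ext_Some: "(\<And>x y. s x = Some y \<longleftrightarrow> t x = Some y) \<Longrightarrow> s = t"
  by (rule ext) (metis not_Some_eq)

lemma inj_on_dom_iff:
  "inj_on s (dom s) \<longleftrightarrow> (\<forall>x x' y. s x = Some y \<longrightarrow> s x' = Some y \<longrightarrow> x = x')"
  unfolding inj_on_def dom_def by (auto; metis)

lemma pinv_eq_Some_iff:
  assumes "inj_on s (dom s)"
  shows "pinv s y = Some x \<longleftrightarrow> s x = Some y"
proof -
  have "(THE x. s x = Some y) = x" if "s x = Some y" for x
    using that assms unfolding inj_on_dom_iff by blast
  then show ?thesis
    unfolding pinv_def ran_def by auto
qed

text \<open>In general \<open>++\<close> lets the right map override the left one. With disjoint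
  domains it is the union of the graphs, and identities for sums are checked in this symmetric
  form.\<close>

lemma map_add_eq_Some_iff:
  assumes "dom s \<inter> dom t = {}"
  shows "(s ++ t) x = Some y \<longleftrightarrow> s x = Some y \<or> t x = Some y"
  using assms by (auto simp: map_add_def dom_def split: option.splits)

lemma comp_map_add:
  assumes "dom t \<inter> dom u = {}"
  shows "s \<circ>\<^sub>m (t ++ u) = (s \<circ>\<^sub>m t) ++ (s \<circ>\<^sub>m u)"
proof -
  have "dom (s \<circ>\<^sub>m t) \<inter> dom (s \<circ>\<^sub>m u) = {}"
    using assms by (auto simp: dom_def map_comp_def split: option.splits)
  then show ?thesis
    by (intro map_ext_Some)
      (auto simp: map_add_eq_Some_iff[OF assms] map_add_eq_Some_iff map_comp_Some_iff)
qed

lemma map_add_comp: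
  assumes "dom t \<inter> dom u = {}"
  shows "(t ++ u) \<circ>\<^sub>m s = (t \<circ>\<^sub>m s) ++ (u \<circ>\<^sub>m s)"
proof -
  have "dom (t \<circ>\<^sub>m s) \<inter> dom (u \<circ>\<^sub>m s) = {}"
    using assms by (auto simp: dom_def map_comp_def split: option.splits)
  then show ?thesis
    by (intro map_ext_Some)
      (auto simp: map_add_eq_Some_iff[OF assms] map_add_eq_Some_iff map_comp_Some_iff)
qed

lemma map_comp_assoc: "(s \<circ>\<^sub>m t) \<circ>\<^sub>m u = s \<circ>\<^sub>m (t \<circ>\<^sub>m u)"
  by (intro map_ext_Some) (auto simp: map_comp_Some_iff)

lemma orth_iff:
  "orth s t \<longleftrightarrow> (\<forall>x y y'. \<not> (s x = Some y \<and> t x = Some y')) \<and>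
    (\<forall>x x' y. \<not> (s x = Some y \<and> t x' = Some y))"
  unfolding orth_def dom_def ran_def by (auto; blast)

lemma orth_sym: "orth s t \<Longrightarrow> orth t s"
  unfolding orth_def by auto

lemma orth_add_iff:
  assumes "dom t \<inter> dom u = {}"
  shows "orth s (t ++ u) \<longleftrightarrow> orth s t \<and> orth s u"
  unfolding orth_iff map_add_eq_Some_iff[OF assms] by blast

lemma inj_add:
  assumes "inj_on s (dom s)" "inj_on t (dom t)" "orth s t"
  shows "inj_on (s ++ t) (dom (s ++ t))"
proof -
  have d: "dom s \<inter> dom t = {}" using assms(3) by (simp add: orth_def)
  show ?thesis
    using assms unfolding inj_on_dom_iff map_add_eq_Some_iff[OF d] orth_iff by blast
qed

lemma orth_pinv:
  assumes "inj_on s (dom s)" "inj_on t (dom t)" "orth s t"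
  shows "orth (pinv s) (pinv t)"
  using assms(3) unfolding orth_iff pinv_eq_Some_iff[OF assms(1)] pinv_eq_Some_iff[OF assms(2)]
  by blast

lemma pinv_add:
  assumes "inj_on s (dom s)" "inj_on t (dom t)" "orth s t"
  shows "pinv (s ++ t) = pinv s ++ pinv t"
proof -
  have d: "dom s \<inter> dom t = {}" using assms(3) by (simp add: orth_def)
  have d': "dom (pinv s) \<inter> dom (pinv t) = {}" using orth_pinv[OF assms] by (simp add: orth_def)
  show ?thesis
    by (intro map_ext_Some)
      (simp add: pinv_eq_Some_iff[OF inj_add[OF assms]] pinv_eq_Some_iff assms
        map_add_eq_Some_iff[OF d] map_add_eq_Some_iff[OF d'])
qed

lemma inj_comp:
  assumes "inj_on s (dom s)" "inj_on t (dom t)"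
  shows "inj_on (s \<circ>\<^sub>m t) (dom (s \<circ>\<^sub>m t))"
  using assms unfolding inj_on_dom_iff map_comp_Some_iff by blast

lemma inj_pinv: "inj_on s (dom s) \<Longrightarrow> inj_on (pinv s) (dom (pinv s))"
  by (subst inj_on_dom_iff) (auto simp: pinv_eq_Some_iff)

lemma pinv_comp:
  assumes "inj_on s (dom s)" "inj_on t (dom t)"
  shows "pinv (s \<circ>\<^sub>m t) = pinv t \<circ>\<^sub>m pinv s"
  by (intro map_ext_Some)
    (auto simp: pinv_eq_Some_iff assms inj_comp map_comp_Some_iff)

lemma pinv_pinv: "inj_on s (dom s) \<Longrightarrow> pinv (pinv s) = s"
  by (intro map_ext_Some) (simp add: pinv_eq_Some_iff inj_pinv)

lemma pinv_comp_self_eq_Some_iff: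
  assumes "inj_on s (dom s)"
  shows "(pinv s \<circ>\<^sub>m s) x = Some y \<longleftrightarrow> x = y \<and> x \<in> dom s"
proof -
  have "x = x'" if "s x = Some z" "s x' = Some z" for x x' z
    using that assms unfolding inj_on_dom_iff by blast
  then show ?thesis
    unfolding map_comp_Some_iff pinv_eq_Some_iff[OF assms] by auto
qed

text \<open>Injectivity of \<open>s\<close> keeps the ranges disjoint. For composition on the other
  side, disjointness of the domains pulls back along any partial map.\<close>

lemma orth_comp_left: "orth t u \<Longrightarrow> inj_on s (dom s) \<Longrightarrow> orth (s \<circ>\<^sub>m t) (s \<circ>\<^sub>m u)"
  unfolding orth_iff map_comp_Some_iff inj_on_dom_iff by blast

lemma orth_comp_right: "orth t u \<Longrightarrow> orth (t \<circ>\<^sub>m s) (u \<circ>\<^sub>m s)"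
  unfolding orth_iff map_comp_Some_iff by fastforce

section \<open>The pseudo full group: closure, measurability and uniform distance\<close>

locale pmp_relation = prob_space M for M :: "'a::polish_space measure" +
  fixes R :: "('a \<times> 'a) set"
  assumes sets_M: "sets M = sets borel" and equiv_R: "equiv UNIV R" and pmp: "pmp_rel M R"
begin

lemma space_M [simp]: "space M = UNIV"
  using sets_eq_imp_space_eq[OF sets_M] by simp

lemma pbij_iff:
  "pbij M R s \<longleftrightarrow> inj_on s (dom s) \<and> (\<forall>x y. s x = Some y \<longrightarrow> (x, y) \<in> R) \<and>
    (\<forall>A\<in>sets M. {x. \<exists>y\<in>A. s x = Some y} \<in> sets M \<and> {y. \<exists>x\<in>A. s x = Some y} \<in> sets M)"
proof -
  have eqs: "{x. \<exists>y\<in>UNIV. s x = Some y} = dom s" "{y. \<exists>x\<in>UNIV. s x = Some y} = ran s"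
    by (auto simp: ran_def)
  have UNIV_sets: "UNIV \<in> sets M" using sets.top[of M] by simp
  have "dom s \<in> sets M \<and> ran s \<in> sets M"
    if "\<forall>A\<in>sets M. {x. \<exists>y\<in>A. s x = Some y} \<in> sets M \<and> {y. \<exists>x\<in>A. s x = Some y} \<in> sets M"
    using bspec[OF that UNIV_sets] unfolding eqs .
  then show ?thesis unfolding pbij_def by blast
qed

lemma pbij_inj: "pbij M R s \<Longrightarrow> inj_on s (dom s)"
  by (simp add: pbij_def)

lemma pbij_dom: "pbij M R s \<Longrightarrow> dom s \<in> sets M"
  by (simp add: pbij_def)

lemma pbij_vimage: "pbij M R s \<Longrightarrow> A \<in> sets M \<Longrightarrow> {x. \<exists>y\<in>A. s x = Some y} \<in> sets M"
  and pbij_image: "pbij M R s \<Longrightarrow> A \<in> sets M \<Longrightarrow> {y. \<exists>x\<in>A. s x = Some y} \<in> sets M"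
  by (auto simp: pbij_iff)

lemma pbij_empty: "pbij M R Map.empty"
  by (simp add: pbij_iff)

lemma pid_eq_Some_iff: "pid M x = Some y \<longleftrightarrow> x = y"
  by (simp add: pid_def)

lemma pbij_pid: "pbij M R (pid M)"
proof -
  have "{x. \<exists>y\<in>A. x = y} = A" "{y. \<exists>x\<in>A. x = y} = A" for A :: "'a set" by auto
  then show ?thesis
    using equiv_R by (simp add: pbij_iff pid_eq_Some_iff inj_on_dom_iff equiv_def refl_on_def)
qed

lemma pbij_pinv: assumes "pbij M R s" shows "pbij M R (pinv s)"
  using assms equiv_R inj_pinv[OF pbij_inj[OF assms]]
  unfolding pbij_iff pinv_eq_Some_iff[OF pbij_inj[OF assms]] equiv_def sym_def by blast

lemma pbij_comp: assumes "pbij M R s" "pbij M R t" shows "pbij M R (s \<circ>\<^sub>m t)"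
  unfolding pbij_iff
proof (intro conjI ballI allI impI)
  show "inj_on (s \<circ>\<^sub>m t) (dom (s \<circ>\<^sub>m t))"
    using assms by (intro inj_comp pbij_inj)
next
  fix x y assume "(s \<circ>\<^sub>m t) x = Some y"
  then obtain z where "t x = Some z" "s z = Some y" by (auto simp: map_comp_Some_iff)
  then have "(x, z) \<in> R" "(z, y) \<in> R" using assms by (auto simp: pbij_iff)
  then show "(x, y) \<in> R" using equiv_R by (meson equiv_def transD)
next
  fix A assume A: "A \<in> sets M"
  have "{x. \<exists>y\<in>A. (s \<circ>\<^sub>m t) x = Some y} = {x. \<exists>y\<in>{x. \<exists>y\<in>A. s x = Some y}. t x = Some y}"
    by (auto simp: map_comp_Some_iff)
  then show "{x. \<exists>y\<in>A. (s \<circ>\<^sub>m t) x = Some y} \<in> sets M"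
    using pbij_vimage[OF assms(2) pbij_vimage[OF assms(1) A]] by simp
  have "{y. \<exists>x\<in>A. (s \<circ>\<^sub>m t) x = Some y} = {y. \<exists>x\<in>{y. \<exists>x\<in>A. t x = Some y}. s x = Some y}"
    by (auto simp: map_comp_Some_iff)
  then show "{y. \<exists>x\<in>A. (s \<circ>\<^sub>m t) x = Some y} \<in> sets M"
    using pbij_image[OF assms(1) pbij_image[OF assms(2) A]] by simp
qed

lemma pbij_add:
  assumes "pbij M R s" "pbij M R t" "orth s t"
  shows "pbij M R (s ++ t)"
proof -
  have d: "dom s \<inter> dom t = {}" using assms(3) by (simp add: orth_def)
  have *: "{x. \<exists>y\<in>A. s x = Some y \<or> t x = Some y}
      = {x. \<exists>y\<in>A. s x = Some y} \<union> {x. \<exists>y\<in>A. t x = Some y}"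
    "{y. \<exists>x\<in>A. s x = Some y \<or> t x = Some y}
      = {y. \<exists>x\<in>A. s x = Some y} \<union> {y. \<exists>x\<in>A. t x = Some y}" for A by auto
  show ?thesis
    unfolding pbij_iff map_add_eq_Some_iff[OF d] *
    using inj_add[OF pbij_inj pbij_inj, OF assms] assms(1,2)
    by (auto simp: pbij_vimage pbij_image) (auto simp: pbij_iff)
qed

lemma pbij_restrict:
  assumes "pbij M R s" "A \<in> sets M"
  shows "pbij M R (s |` A)"
proof -
  have eq: "(s |` A) x = Some y \<longleftrightarrow> x \<in> A \<and> s x = Some y" for x y
    by (auto simp: restrict_map_def)
  have "{x. \<exists>y\<in>B. x \<in> A \<and> s x = Some y} = A \<inter> {x. \<exists>y\<in>B. s x = Some y}"
    "{y. \<exists>x\<in>B. x \<in> A \<and> s x = Some y} = {y. \<exists>x\<in>A \<inter> B. s x = Some y}" for B by auto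
  moreover have "inj_on (s |` A) (dom (s |` A))"
    using pbij_inj[OF assms(1)] unfolding inj_on_dom_iff eq by blast
  ultimately show ?thesis
    using assms unfolding pbij_iff[of "s |` A"] eq
    by (simp add: pbij_vimage pbij_image sets.Int) (simp add: pbij_iff)
qed

text \<open>Sending points outside the domain to themselves makes \<open>s\<close> a total Borel map
  of a Polish space. Two such maps coincide on a Borel set, which is how agreement sets of partial
  maps become measurable.\<close>

lemma measurable_total:
  assumes "pbij M R s"
  shows "(\<lambda>x. case s x of Some y \<Rightarrow> y | None \<Rightarrow> x) \<in> borel_measurable M"
proof (rule measurableI)
  fix A :: "'a set" assume "A \<in> sets borel"
  then have A: "A \<in> sets M" by (simp add: sets_M)
  have "(\<lambda>x. case s x of Some y \<Rightarrow> y | None \<Rightarrow> x) -` A \<inter> space M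
      = {x. \<exists>y\<in>A. s x = Some y} \<union> (A - dom s)"
    by (auto split: option.splits)
  also have "\<dots> \<in> sets M"
    using A assms by (intro sets.Un sets.Diff pbij_vimage pbij_dom)
  finally show "(\<lambda>x. case s x of Some y \<Rightarrow> y | None \<Rightarrow> x) -` A \<inter> space M \<in> sets M" .
qed auto

lemma sets_agree:
  assumes "pbij M R s" "pbij M R t"
  shows "{x. s x = t x \<and> s x \<noteq> None} \<in> sets M"
proof -
  let ?f = "\<lambda>s x. case s x of Some y \<Rightarrow> y | None \<Rightarrow> x"
  have "{x \<in> space M. ?f s x = ?f t x} \<in> sets M"
    using measurable_total[OF assms(1)] measurable_total[OF assms(2)] by measurable
  then have "dom s \<inter> dom t \<inter> {x \<in> space M. ?f s x = ?f t x} \<in> sets M"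
    using assms by (intro sets.Int pbij_dom)
  also have "dom s \<inter> dom t \<inter> {x \<in> space M. ?f s x = ?f t x} = {x. s x = t x \<and> s x \<noteq> None}"
    by (auto simp: dom_def split: option.splits) (metis option.exhaust)
  finally show ?thesis .
qed

lemma sets_differ:
  assumes "pbij M R s" "pbij M R t"
  shows "{x. s x \<noteq> t x} \<in> sets M"
proof -
  have "{x. s x \<noteq> t x} = (dom s \<union> dom t) - {x. s x = t x \<and> s x \<noteq> None}" by (auto simp: dom_def)
  also have "\<dots> \<in> sets M"
    using assms by (intro sets.Un sets.Diff sets_agree pbij_dom)
  finally show ?thesis .
qed

lemma sets_fix: "pbij M R s \<Longrightarrow> {x. s x = Some x} \<in> sets M"
proof -
  assume s: "pbij M R s"
  have "{x. s x = Some x} = {x. s x = pid M x \<and> s x \<noteq> None}" by (auto simp: pid_def)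
  then show ?thesis using sets_agree[OF s pbij_pid] by simp
qed

lemma measure_ran: "pbij M R s \<Longrightarrow> measure M (ran s) = measure M (dom s)"
  using pmp by (simp add: pmp_rel_def measure_def)

text \<open>The image of \<open>A\<close> is the range of the restriction of \<open>s\<close> to
  \<open>A\<close>. This restriction is again in the pseudo full group, so invariance of the measure
  applies to it.\<close>

lemma measure_image_le:
  assumes s: "pbij M R s" and A: "A \<in> sets M"
  shows "measure M {y. \<exists>x\<in>A. s x = Some y} \<le> measure M A"
proof -
  have "{y. \<exists>x\<in>A. s x = Some y} = ran (s |` A)"
    by (auto simp: ran_def restrict_map_def)
  then have "measure M {y. \<exists>x\<in>A. s x = Some y} = measure M (dom (s |` A))"
    using measure_ran[OF pbij_restrict[OF assms]] by simp
  also have "\<dots> \<le> measure M A"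
    using A by (intro finite_measure_mono) auto
  finally show ?thesis .
qed

lemma measure_vimage_le:
  assumes s: "pbij M R s" and A: "A \<in> sets M"
  shows "measure M {x. \<exists>y\<in>A. s x = Some y} \<le> measure M A"
  using measure_image_le[OF pbij_pinv[OF s] A] by (simp add: pinv_eq_Some_iff pbij_inj s)

lemma udist_sym: "udist M s t = udist M t s"
  unfolding udist_def by (rule arg_cong[of _ _ "measure M"]) auto

lemma udist_nonneg: "0 \<le> udist M s t"
  by (simp add: udist_def)

lemma udist_triangle:
  assumes "pbij M R s" "pbij M R t" "pbij M R u"
  shows "udist M s u \<le> udist M s t + udist M t u"
proof -
  have "udist M s u \<le> measure M ({x. s x \<noteq> t x} \<union> {x. t x \<noteq> u x})"
    unfolding udist_def using assms by (intro finite_measure_mono sets.Un sets_differ) auto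
  also have "\<dots> \<le> udist M s t + udist M t u"
    unfolding udist_def using assms by (intro measure_Un_le sets_differ)
  finally show ?thesis .
qed

text \<open>Where \<open>t\<close> and \<open>t'\<close> agree, the products can differ only if
  \<open>t\<close> leads into the set where \<open>s\<close> and \<open>s'\<close> differ, and
  pulling back along \<open>t\<close> does not increase measure.\<close>

lemma udist_comp:
  assumes "pbij M R s" "pbij M R t" "pbij M R s'" "pbij M R t'"
  shows "udist M (s \<circ>\<^sub>m t) (s' \<circ>\<^sub>m t') \<le> udist M s s' + udist M t t'"
proof -
  let ?A = "{x. \<exists>y\<in>{y. s y \<noteq> s' y}. t x = Some y}"
  have m: "?A \<in> sets M" "{x. t x \<noteq> t' x} \<in> sets M"
    using assms by (blast intro: pbij_vimage sets_differ)+
  have "{x. (s \<circ>\<^sub>m t) x \<noteq> (s' \<circ>\<^sub>m t') x} \<subseteq> ?A \<union> {x. t x \<noteq> t' x}"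
  proof
    fix x assume "x \<in> {x. (s \<circ>\<^sub>m t) x \<noteq> (s' \<circ>\<^sub>m t') x}"
    then show "x \<in> ?A \<union> {x. t x \<noteq> t' x}"
      by (cases "t x"; cases "t x = t' x") (auto simp: map_comp_def)
  qed
  then have "udist M (s \<circ>\<^sub>m t) (s' \<circ>\<^sub>m t') \<le> measure M (?A \<union> {x. t x \<noteq> t' x})"
    unfolding udist_def using m by (intro finite_measure_mono sets.Un)
  also have "\<dots> \<le> measure M ?A + measure M {x. t x \<noteq> t' x}"
    using m by (intro measure_Un_le)
  also have "measure M ?A \<le> measure M {y. s y \<noteq> s' y}"
    using assms by (intro measure_vimage_le sets_differ)
  finally show ?thesis unfolding udist_def by simp
qed

text \<open>A point where the inverses differ is the image, under \<open>s\<close> or under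
  \<open>t\<close>, of a point where \<open>s\<close> and \<open>t\<close> differ. Both images can
  count: maps with a common domain and disjoint ranges have inverses that differ on both ranges,
  whence the factor 2.\<close>

lemma udist_pinv:
  assumes s: "pbij M R s" and t: "pbij M R t"
  shows "udist M (pinv s) (pinv t) \<le> 2 * udist M s t"
proof -
  let ?N = "{x. s x \<noteq> t x}"
  let ?A = "{y. \<exists>x\<in>?N. s x = Some y}" and ?B = "{y. \<exists>x\<in>?N. t x = Some y}"
  have N: "?N \<in> sets M" using assms by (rule sets_differ)
  have m: "?A \<in> sets M" "?B \<in> sets M"
    using assms N by (blast intro: pbij_image)+
  have "{y. pinv s y \<noteq> pinv t y} \<subseteq> ?A \<union> ?B"
  proof
    fix y assume "y \<in> {y. pinv s y \<noteq> pinv t y}"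
    then obtain x where "pinv s y = Some x \<and> pinv t y \<noteq> Some x \<or> pinv t y = Some x \<and> pinv s y \<noteq> Some x"
      by (metis (mono_tags, lifting) mem_Collect_eq option.exhaust)
    then show "y \<in> ?A \<union> ?B"
      unfolding pinv_eq_Some_iff[OF pbij_inj[OF s]] pinv_eq_Some_iff[OF pbij_inj[OF t]]
      by fastforce
  qed
  then have "udist M (pinv s) (pinv t) \<le> measure M (?A \<union> ?B)"
    unfolding udist_def using m by (intro finite_measure_mono) auto
  also have "\<dots> \<le> measure M ?A + measure M ?B" using m by (intro measure_Un_le)
  also have "\<dots> \<le> 2 * measure M ?N"
    using measure_image_le[OF s N] measure_image_le[OF t N] by simp
  finally show ?thesis by (simp add: udist_def)
qed

lemma udist_eq_0_iff:
  assumes "pbij M R s" "pbij M R t"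
  shows "udist M s t = 0 \<longleftrightarrow> (AE x in M. s x = t x)"
proof -
  have "(AE x in M. s x = t x) \<longleftrightarrow> emeasure M {x. s x \<noteq> t x} = 0"
    using sets_differ[OF assms] by (subst AE_iff_measurable[of "{x. s x \<noteq> t x}"]) auto
  then show ?thesis by (simp add: udist_def emeasure_eq_measure)
qed

lemma trace_diff_le_udist:
  assumes "pbij M R s" "pbij M R t"
  shows "\<bar>trace M s - trace M t\<bar> \<le> udist M s t"
proof -
  have *: "trace M s \<le> trace M t + udist M s t" if "pbij M R s" "pbij M R t" for s t
  proof -
    have "trace M s \<le> measure M ({x. t x = Some x} \<union> {x. s x \<noteq> t x})"
      unfolding trace_def using that
      by (intro finite_measure_mono sets.Un sets_fix sets_differ) auto
    also have "\<dots> \<le> trace M t + udist M s t"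
      unfolding trace_def udist_def using that by (intro measure_Un_le sets_fix sets_differ)
    finally show ?thesis .
  qed
  from *[OF assms] *[OF assms(2,1)] show ?thesis by (simp add: udist_sym abs_le_iff)
qed

end

section \<open>Orthogonal sums of words\<close>

lemma foldr_orth_iff:
  "sorted_wrt orth ss \<Longrightarrow>
    orth u (foldr (\<lambda>s acc. s ++ acc) ss Map.empty) \<longleftrightarrow> (\<forall>s\<in>set ss. orth u s)"
proof (induction ss arbitrary: u)
  case Nil
  then show ?case by (simp add: orth_def)
next
  case (Cons s ss)
  then have "orth s (foldr (\<lambda>s acc. s ++ acc) ss Map.empty)" by simp
  then have "dom s \<inter> dom (foldr (\<lambda>s acc. s ++ acc) ss Map.empty) = {}" by (simp add: orth_def)
  from orth_add_iff[OF this] Cons show ?case by simp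
qed

text \<open>Orthogonality is symmetric, so the condition on all index pairs reduces to ordered
  pairs. The recursive form of \<open>sorted_wrt\<close> then permits induction over the list of
  summands.\<close>

lemma osums_alt:
  "osums S = {foldr (\<lambda>s acc. s ++ acc) ss Map.empty | ss. set ss \<subseteq> S \<and> sorted_wrt orth ss}"
proof -
  have "(\<forall>i<length ss. \<forall>j<length ss. i \<noteq> j \<longrightarrow> orth (ss ! i) (ss ! j)) \<longleftrightarrow> sorted_wrt orth ss"
    for ss :: "('a \<rightharpoonup> 'a) list"
    unfolding sorted_wrt_iff_nth_less by (auto elim!: linorder_neqE_nat intro: orth_sym)
  then show ?thesis unfolding osums_def by simp
qed

lemma osums_empty: "Map.empty \<in> osums S"
  unfolding osums_alt by (rule CollectI, rule exI[of _ "[]"]) simp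

lemma osums_add:
  assumes "s \<in> S" "t \<in> osums S" "orth s t"
  shows "s ++ t \<in> osums S"
proof -
  obtain ss where ss: "t = foldr (\<lambda>s acc. s ++ acc) ss Map.empty" "set ss \<subseteq> S" "sorted_wrt orth ss"
    using assms(2) unfolding osums_alt by blast
  have "\<forall>u\<in>set ss. orth s u" using foldr_orth_iff[OF ss(3)] assms(3) ss(1) by simp
  then show ?thesis
    unfolding osums_alt using ss assms(1) by (intro CollectI exI[of _ "s # ss"]) simp
qed

text \<open>The head of the list is orthogonal to each later summand and hence, by
  \<open>foldr_orth_iff\<close>, to their whole sum. This is the form in which
  \<open>inj_add\<close> and \<open>pinv_add\<close> apply.\<close>

lemma osums_induct [consumes 1, case_names empty add]:
  assumes "t \<in> osums S" and "P Map.empty"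
    and "\<And>s t. s \<in> S \<Longrightarrow> t \<in> osums S \<Longrightarrow> P t \<Longrightarrow> orth s t \<Longrightarrow> P (s ++ t)"
  shows "P t"
proof -
  obtain ss where ss: "t = foldr (\<lambda>s acc. s ++ acc) ss Map.empty" "set ss \<subseteq> S" "sorted_wrt orth ss"
    using assms(1) unfolding osums_alt by blast
  show ?thesis
    unfolding ss(1) using ss(2,3)
  proof (induction ss)
    case Nil
    then show ?case using assms(2) by simp
  next
    case (Cons s ss)
    have "foldr (\<lambda>s acc. s ++ acc) ss Map.empty \<in> osums S"
      unfolding osums_alt using Cons.prems by (intro CollectI exI[of _ ss]) simp
    moreover have "orth s (foldr (\<lambda>s acc. s ++ acc) ss Map.empty)"
      using Cons.prems by (simp add: foldr_orth_iff)
    ultimately show ?case using Cons assms(3) by simp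
  qed
qed

lemma osums_add_osums:
  assumes "t \<in> osums S" "u \<in> osums S" "orth t u"
  shows "t ++ u \<in> osums S"
  using assms(1,3)
proof (induction rule: osums_induct)
  case empty
  then show ?case using assms(2) by simp
next
  case (add s t)
  have d: "dom s \<inter> dom t = {}" using add.hyps by (simp add: orth_def)
  have o: "orth s u" "orth t u"
    using add.prems orth_add_iff[OF d, of u] by (auto dest: orth_sym)
  then have "dom t \<inter> dom u = {}" by (simp add: orth_def)
  from orth_add_iff[OF this] have "orth s (t ++ u)" using add.hyps o by simp
  then have "s ++ (t ++ u) \<in> osums S" using add o by (blast intro: osums_add)
  then show ?case by simp
qed

lemma osums_inj:
  assumes "t \<in> osums S" "\<And>s. s \<in> S \<Longrightarrow> inj_on s (dom s)"
  shows "inj_on t (dom t)"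
  using assms(1) by (induction rule: osums_induct) (simp, blast intro: inj_add assms(2))

text \<open>Products distribute over orthogonal sums on both sides. The outer induction splits the
  right factor, the inner one the left factor. Left multiplication preserves orthogonality because
  \<open>a\<close>, an orthogonal sum of injective maps, is injective.\<close>

lemma osums_comp:
  assumes a: "a \<in> osums S" and b: "b \<in> osums S'"
    and "\<And>s s'. s \<in> S \<Longrightarrow> s' \<in> S' \<Longrightarrow> s \<circ>\<^sub>m s' \<in> S''"
    and inj: "\<And>s. s \<in> S \<Longrightarrow> inj_on s (dom s)"
  shows "a \<circ>\<^sub>m b \<in> osums S''"
  using b
proof (induction rule: osums_induct)
  case empty
  then show ?case by (simp add: osums_empty)
next
  case (add u b)
  have "a \<circ>\<^sub>m u \<in> osums S''"
    using a
  proof (induction rule: osums_induct)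
    case empty
    then show ?case by (simp add: osums_empty)
  next
    case (add s t)
    then have d: "dom s \<inter> dom t = {}" by (simp add: orth_def)
    show ?case
      unfolding map_add_comp[OF d] using add \<open>u \<in> S'\<close> assms(3)
      by (intro osums_add orth_comp_right)
  qed
  moreover have "dom u \<inter> dom b = {}" using add by (simp add: orth_def)
  ultimately show ?case
    using add osums_inj[OF a inj] by (simp add: comp_map_add osums_add_osums orth_comp_left)
qed

lemma pinv_empty [simp]: "pinv Map.empty = Map.empty"
  by (simp add: pinv_def)

lemma osums_pinv:
  assumes a: "a \<in> osums S" and "\<And>s. s \<in> S \<Longrightarrow> pinv s \<in> S'"
    and inj: "\<And>s. s \<in> S \<Longrightarrow> inj_on s (dom s)"
  shows "pinv a \<in> osums S'"
  using a
proof (induction rule: osums_induct)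
  case empty
  then show ?case by (simp add: osums_empty)
next
  case (add s t)
  have "inj_on s (dom s)" "inj_on t (dom t)" using add inj osums_inj by blast+
  then show ?case
    using add assms(2) by (simp add: pinv_add osums_add orth_pinv)
qed

section \<open>Words and their orthogonal sums modulo null sets\<close>

context pmp_relation
begin

text \<open>Almost everywhere equality is distance 0, so the Lipschitz bound
  \<open>udist_comp\<close> takes care of preimages of null sets.\<close>

lemma AE_eq_comp:
  assumes "pbij M R s" "pbij M R t" "pbij M R s'" "pbij M R t'"
    and "AE x in M. s x = s' x" "AE x in M. t x = t' x"
  shows "AE x in M. (s \<circ>\<^sub>m t) x = (s' \<circ>\<^sub>m t') x"
proof -
  have "udist M s s' = 0" "udist M t t' = 0" using assms by (simp_all add: udist_eq_0_iff)
  then have "udist M (s \<circ>\<^sub>m t) (s' \<circ>\<^sub>m t') = 0"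
    using udist_comp[OF assms(1-4)] udist_nonneg[of "s \<circ>\<^sub>m t" "s' \<circ>\<^sub>m t'"] by simp
  then show ?thesis using assms by (simp add: udist_eq_0_iff pbij_comp)
qed

lemma AE_eq_pinv:
  assumes "pbij M R s" "pbij M R t" and "AE x in M. s x = t x"
  shows "AE x in M. pinv s x = pinv t x"
proof -
  have "udist M s t = 0" using assms by (simp add: udist_eq_0_iff)
  then have "udist M (pinv s) (pinv t) = 0"
    using udist_pinv[OF assms(1,2)] udist_nonneg[of "pinv s" "pinv t"] by simp
  then show ?thesis using assms by (simp add: udist_eq_0_iff pbij_pinv)
qed

lemma AE_eq_trans:
  "AE x in M. s x = t x \<Longrightarrow> AE x in M. t x = u x \<Longrightarrow> AE x in M. s x = u x"
  by (elim AE_mp) auto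

lemma AE_eq_sym: "AE x in M. s x = t x \<Longrightarrow> AE x in M. t x = s x"
  by (elim AE_mp) auto

lemma aeclose_pbij: "s \<in> aeclose M R S \<Longrightarrow> pbij M R s"
  by (simp add: aeclose_def)

lemma aeclose_superset: "S \<subseteq> {s. pbij M R s} \<Longrightarrow> S \<subseteq> aeclose M R S"
  by (auto simp: aeclose_def)

lemma aeclose_comp:
  assumes "S \<subseteq> {s. pbij M R s}" "T \<subseteq> {s. pbij M R s}"
    and "\<And>s t. s \<in> S \<Longrightarrow> t \<in> T \<Longrightarrow> s \<circ>\<^sub>m t \<in> U"
    and "a \<in> aeclose M R S" "b \<in> aeclose M R T"
  shows "a \<circ>\<^sub>m b \<in> aeclose M R U"
proof -
  obtain s t where "s \<in> S" "AE x in M. a x = s x" "t \<in> T" "AE x in M. b x = t x"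
    "pbij M R a" "pbij M R b"
    using assms(4,5) unfolding aeclose_def by blast
  moreover from this have "AE x in M. (a \<circ>\<^sub>m b) x = (s \<circ>\<^sub>m t) x"
    using assms(1,2) by (intro AE_eq_comp) auto
  ultimately show ?thesis unfolding aeclose_def using assms(3) by (blast intro: pbij_comp)
qed

lemma aeclose_pinv:
  assumes "S \<subseteq> {s. pbij M R s}" "\<And>s. s \<in> S \<Longrightarrow> pinv s \<in> U" "a \<in> aeclose M R S"
  shows "pinv a \<in> aeclose M R U"
proof -
  obtain s where "s \<in> S" "AE x in M. a x = s x" "pbij M R a"
    using assms(3) unfolding aeclose_def by blast
  moreover from this have "AE x in M. pinv a x = pinv s x"
    using assms(1) by (intro AE_eq_pinv) auto
  ultimately show ?thesis unfolding aeclose_def using assms(2) by (blast intro: pbij_pinv)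
qed

lemma pid_comp [simp]: "pid M \<circ>\<^sub>m s = s"
  by (intro map_ext_Some) (auto simp: map_comp_Some_iff pid_eq_Some_iff)

lemma comp_pid [simp]: "s \<circ>\<^sub>m pid M = s"
  by (intro map_ext_Some) (auto simp: map_comp_Some_iff pid_eq_Some_iff)

lemma pinv_pid [simp]: "pinv (pid M) = pid M"
  by (intro map_ext_Some) (auto simp: pinv_eq_Some_iff pbij_inj pbij_pid pid_eq_Some_iff)

lemma prods_pbij: "S \<subseteq> {s. pbij M R s} \<Longrightarrow> prods M S n \<subseteq> {s. pbij M R s}"
  by (induction n) (auto simp: pbij_pid intro: pbij_comp)

lemma prods_comp: "s \<in> prods M S m \<Longrightarrow> t \<in> prods M S n \<Longrightarrow> s \<circ>\<^sub>m t \<in> prods M S (m + n)"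
  by (induction m arbitrary: s) (auto simp: map_comp_assoc, blast)

lemma prods_one: "s \<in> S \<Longrightarrow> s \<in> prods M S 1"
  by auto

text \<open>Inversion reverses a word: the letter split off on the left reappears on the right, so
  \<open>prods_comp\<close> is used in place of the recursion for \<open>prods\<close>.\<close>

lemma prods_pinv:
  assumes "S \<subseteq> {s. pbij M R s}" "\<And>s. s \<in> S \<Longrightarrow> pinv s \<in> S"
  shows "s \<in> prods M S n \<Longrightarrow> pinv s \<in> prods M S n"
proof (induction n arbitrary: s)
  case 0
  then show ?case by simp
next
  case (Suc n)
  then obtain u t where ut: "s = u \<circ>\<^sub>m t" "u \<in> S" "t \<in> prods M S n" by auto
  then have "pbij M R u" "pbij M R t" using assms(1) prods_pbij by blast+
  then have "pinv s = pinv t \<circ>\<^sub>m pinv u" by (simp add: ut pinv_comp pbij_inj)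
  also have "\<dots> \<in> prods M S (n + 1)"
    using ut Suc.IH assms(2) by (intro prods_comp prods_one)
  finally show ?case by simp
qed

lemma finite_prods: "finite S \<Longrightarrow> finite (prods M S n)"
  by (induction n) (auto intro: finite_image_set2)

lemma prods_pid: "pid M \<in> S \<Longrightarrow> pid M \<in> prods M S n"
  by (induction n) (auto intro!: exI[of _ "pid M"])

context
  fixes F :: "('a \<rightharpoonup> 'a) set"
  assumes F: "F \<subseteq> {s. pbij M R s}"
begin

lemma Fpm_pbij: "Fpm M F \<subseteq> {s. pbij M R s}"
  using F by (auto simp: Fpm_def pbij_pid intro: pbij_pinv)

lemma Fpm_pinv: "s \<in> Fpm M F \<Longrightarrow> pinv s \<in> Fpm M F"
  using F by (auto simp: Fpm_def pinv_pinv pbij_inj)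

abbreviation words :: "nat \<Rightarrow> ('a \<rightharpoonup> 'a) set" where
  "words n \<equiv> aeclose M R (prods M (Fpm M F) n)"

lemma words_comp: "s \<in> words m \<Longrightarrow> t \<in> words n \<Longrightarrow> s \<circ>\<^sub>m t \<in> words (m + n)"
  by (rule aeclose_comp[OF prods_pbij[OF Fpm_pbij] prods_pbij[OF Fpm_pbij]]) (auto intro: prods_comp)

lemma words_pinv: "s \<in> words n \<Longrightarrow> pinv s \<in> words n"
  by (rule aeclose_pinv[OF prods_pbij[OF Fpm_pbij]]) (auto intro: prods_pinv[OF Fpm_pbij Fpm_pinv])

lemma osums_pbij:
  assumes "t \<in> osums S" "S \<subseteq> {s. pbij M R s}"
  shows "pbij M R t"
  using assms(1)
  by (induction rule: osums_induct) (use assms(2) in \<open>auto intro: pbij_empty pbij_add\<close>)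

lemma osums_words_pbij: "osums (words n) \<subseteq> {s. pbij M R s}"
  using osums_pbij[of _ "words n"] aeclose_pbij by blast

lemma SigmaPow_pbij: "s \<in> SigmaPow M R F n \<Longrightarrow> pbij M R s"
  by (simp add: SigmaPow_def aeclose_pbij)

lemma SigmaPow_AE:
  "s \<in> SigmaPow M R F n \<Longrightarrow> pbij M R t \<Longrightarrow> AE x in M. t x = s x \<Longrightarrow> t \<in> SigmaPow M R F n"
  unfolding SigmaPow_def aeclose_def[of M R "osums _"]
  by (auto intro: AE_eq_trans)

lemma SigmaPow_comp:
  "s \<in> SigmaPow M R F m \<Longrightarrow> t \<in> SigmaPow M R F n \<Longrightarrow> s \<circ>\<^sub>m t \<in> SigmaPow M R F (m + n)"
  unfolding SigmaPow_def
  by (rule aeclose_comp[OF osums_words_pbij osums_words_pbij])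
    (auto intro: osums_comp words_comp pbij_inj aeclose_pbij)

lemma SigmaPow_pinv: "s \<in> SigmaPow M R F n \<Longrightarrow> pinv s \<in> SigmaPow M R F n"
  unfolding SigmaPow_def
  by (rule aeclose_pinv[OF osums_words_pbij])
    (auto intro: osums_pinv words_pinv pbij_inj aeclose_pbij)

lemma osums_words_SigmaPow: "s \<in> osums (words n) \<Longrightarrow> s \<in> SigmaPow M R F n"
  using subsetD[OF aeclose_superset[OF osums_words_pbij]] unfolding SigmaPow_def .

lemma words_SigmaPow: "s \<in> words n \<Longrightarrow> s \<in> SigmaPow M R F n"
  using osums_add[OF _ osums_empty, of s "words n"]
  by (intro osums_words_SigmaPow) (simp add: orth_def)

lemma prods_SigmaPow: "s \<in> prods M (Fpm M F) n \<Longrightarrow> s \<in> SigmaPow M R F n"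
  by (rule words_SigmaPow[OF subsetD[OF aeclose_superset[OF prods_pbij[OF Fpm_pbij]]]])

lemma SigmaPow_empty: "Map.empty \<in> SigmaPow M R F n"
  by (intro osums_words_SigmaPow osums_empty)

lemma SigmaPow_pid: "pid M \<in> SigmaPow M R F n"
  by (intro prods_SigmaPow prods_pid) (simp add: Fpm_def)

text \<open>A factor \<open>pid M\<close>, taken at level \<open>n - m\<close>, raises the level
  without changing the map.\<close>

lemma SigmaPow_mono: "m \<le> n \<Longrightarrow> s \<in> SigmaPow M R F m \<Longrightarrow> s \<in> SigmaPow M R F n"
  using SigmaPow_comp[OF _ SigmaPow_pid, of s m "n - m"] by simp

lemma subset_SigmaPow_one: "F \<subseteq> SigmaPow M R F 1"
  using prods_SigmaPow[OF prods_one] by (auto simp: Fpm_def)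

text \<open>Up to a null set, the graph of an orthogonal sum is the union of the graphs of the words
  representing its summands. The summands equal words only almost everywhere, so these words may
  fail to be orthogonal on a null set; the pointwise description avoids forming their sum.\<close>

lemma SigmaPow_graph:
  assumes "t \<in> SigmaPow M R F n"
  shows "\<exists>U\<subseteq>prods M (Fpm M F) n. AE x in M. \<forall>y. t x = Some y \<longleftrightarrow> (\<exists>w\<in>U. w x = Some y)"
proof -
  obtain t' where t': "t' \<in> osums (words n)" "AE x in M. t x = t' x"
    using assms unfolding SigmaPow_def aeclose_def[of M R "osums _"] by auto
  from t'(1) have "\<exists>U\<subseteq>prods M (Fpm M F) n. AE x in M. \<forall>y. t' x = Some y \<longleftrightarrow> (\<exists>w\<in>U. w x = Some y)"
  proof (induction rule: osums_induct)
    case empty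
    then show ?case by (intro exI[of _ "{}"]) simp
  next
    case (add s t)
    obtain w where w: "w \<in> prods M (Fpm M F) n" "AE x in M. s x = w x"
      using add.hyps unfolding aeclose_def by blast
    obtain U where U: "U \<subseteq> prods M (Fpm M F) n"
      "AE x in M. \<forall>y. t x = Some y \<longleftrightarrow> (\<exists>w\<in>U. w x = Some y)"
      using add.IH by blast
    have d: "dom s \<inter> dom t = {}" using add.hyps by (simp add: orth_def)
    have "AE x in M. \<forall>y. (s ++ t) x = Some y \<longleftrightarrow> (\<exists>w\<in>insert w U. w x = Some y)"
      using w(2) U(2) by eventually_elim (simp add: map_add_eq_Some_iff[OF d] del: map_add_Some_iff)
    then show ?case using w U by (intro exI[of _ "insert w U"]) simp
  qed
  then obtain U where "U \<subseteq> prods M (Fpm M F) n"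
    "AE x in M. \<forall>y. t' x = Some y \<longleftrightarrow> (\<exists>w\<in>U. w x = Some y)" by blast
  moreover from this(2) t'(2) have "AE x in M. \<forall>y. t x = Some y \<longleftrightarrow> (\<exists>w\<in>U. w x = Some y)"
    by eventually_elim simp
  ultimately show ?thesis by blast
qed

text \<open>By \<open>SigmaPow_graph\<close> a set \<open>U\<close> of words describes
  \<open>t\<close> up to a null set. A finite alphabet has finitely many words of length
  \<open>n\<close>, hence finitely many such sets, and one element is picked for each set that
  occurs.\<close>

lemma SigmaPow_finite_mod_AE:
  assumes "finite F"
  obtains T where "finite T" "T \<subseteq> SigmaPow M R F n"
    "\<And>t. t \<in> SigmaPow M R F n \<Longrightarrow> \<exists>u\<in>T. AE x in M. t x = u x"
proof -
  define Q where "Q U t \<longleftrightarrow> t \<in> SigmaPow M R F n \<and>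
    (AE x in M. \<forall>y. t x = Some y \<longleftrightarrow> (\<exists>w\<in>U. w x = Some y))" for U t
  define pick where "pick U = (SOME t. Q U t)" for U
  have pick: "Q U (pick U)" if "Q U t" for U t
    unfolding pick_def using that by (rule someI[of "Q U"])
  have fin: "finite (prods M (Fpm M F) n)"
    using assms by (intro finite_prods) (simp add: Fpm_def)
  show ?thesis
  proof
    show "finite (pick ` {U \<in> Pow (prods M (Fpm M F) n). \<exists>t. Q U t})"
      using fin by simp
    show "pick ` {U \<in> Pow (prods M (Fpm M F) n). \<exists>t. Q U t} \<subseteq> SigmaPow M R F n"
      using pick by (auto simp: Q_def)
  next
    fix t assume t: "t \<in> SigmaPow M R F n"
    then obtain U where U: "U \<subseteq> prods M (Fpm M F) n" "Q U t"
      using SigmaPow_graph[OF t] by (auto simp: Q_def)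
    from pick[OF U(2)] U(2) have "AE x in M. t x = pick U x"
      unfolding Q_def
    proof (elim conjE)
      assume "AE x in M. \<forall>y. t x = Some y \<longleftrightarrow> (\<exists>w\<in>U. w x = Some y)"
        "AE x in M. \<forall>y. pick U x = Some y \<longleftrightarrow> (\<exists>w\<in>U. w x = Some y)"
      then show ?thesis by eventually_elim (metis not_Some_eq)
    qed
    then show "\<exists>u\<in>pick ` {U \<in> Pow (prods M (Fpm M F) n). \<exists>t. Q U t}. AE x in M. t x = u x"
      using U by blast
  qed
qed

end

end

section \<open>Counting for partial permutations\<close>

lemma finite_differ:
  assumes "finite (dom A)" "finite (dom B)"
  shows "finite {i. A i \<noteq> B i}"
proof (rule finite_subset)
  show "{i. A i \<noteq> B i} \<subseteq> dom A \<union> dom B" by (auto simp: dom_def)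
qed (use assms in simp)

lemma finite_fixpoints: "finite (dom A) \<Longrightarrow> finite {i. A i = Some i}"
  by (rule finite_subset[of _ "dom A"]) auto

lemma finite_agree: "finite (dom A) \<Longrightarrow> finite {i. A i = B i \<and> A i \<noteq> None}"
  by (rule finite_subset[of _ "dom A"]) auto

lemma finite_dom_comp: "finite (dom B) \<Longrightarrow> finite (dom (A \<circ>\<^sub>m B))"
  by (rule finite_subset[of _ "dom B"]) (auto simp: map_comp_Some_iff)

text \<open>If \<open>P i = Some j\<close> and \<open>P\<close> agrees with its square at
  \<open>i\<close>, then \<open>P j = Some j\<close>, and injectivity gives \<open>i = j\<close>. So
  each point of the domain is fixed or counts as a defect of idempotence.\<close>

lemma card_dom_le_fixpoints:
  assumes "finite (dom P)" "inj_on P (dom P)"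
  shows "card (dom P) \<le> card {i. P i = Some i} + card {i. P i \<noteq> (P \<circ>\<^sub>m P) i}"
proof -
  have "dom P \<subseteq> {i. P i = Some i} \<union> {i. P i \<noteq> (P \<circ>\<^sub>m P) i}"
  proof
    fix i assume "i \<in> dom P"
    then obtain j where j: "P i = Some j" by auto
    have "i = j" if "P j = Some j"
      using assms(2) that j unfolding inj_on_dom_iff by blast
    then show "i \<in> {i. P i = Some i} \<union> {i. P i \<noteq> (P \<circ>\<^sub>m P) i}"
      using j by auto
  qed
  then have "card (dom P) \<le> card ({i. P i = Some i} \<union> {i. P i \<noteq> (P \<circ>\<^sub>m P) i})"
    using assms(1) by (intro card_mono finite_UnI finite_fixpoints finite_differ finite_dom_comp)
  also have "\<dots> \<le> card {i. P i = Some i} + card {i. P i \<noteq> (P \<circ>\<^sub>m P) i}" by (rule card_Un_le)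
  finally show ?thesis .
qed

lemma card_dom_le_comp:
  assumes "finite (dom A)" "finite (dom P)"
  shows "card (dom A) \<le> card (dom P) + card {i. A i \<noteq> (A \<circ>\<^sub>m P) i}"
proof -
  have "dom A \<subseteq> dom P \<union> {i. A i \<noteq> (A \<circ>\<^sub>m P) i}"
    by (auto simp: map_comp_def split: option.splits)
  then have "card (dom A) \<le> card (dom P \<union> {i. A i \<noteq> (A \<circ>\<^sub>m P) i})"
    using assms by (intro card_mono finite_UnI finite_differ finite_dom_comp)
  also have "\<dots> \<le> card (dom P) + card {i. A i \<noteq> (A \<circ>\<^sub>m P) i}" by (rule card_Un_le)
  finally show ?thesis .
qed

lemma card_fixpoints_le:
  assumes "finite (dom A)" "finite (dom B)"
  shows "card {i. A i = Some i} \<le> card {i. B i = Some i} + card {i. A i \<noteq> B i}"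
proof -
  have "card {i. A i = Some i} \<le> card ({i. B i = Some i} \<union> {i. A i \<noteq> B i})"
    using assms by (intro card_mono finite_UnI finite_fixpoints finite_differ) auto
  also have "\<dots> \<le> card {i. B i = Some i} + card {i. A i \<noteq> B i}" by (rule card_Un_le)
  finally show ?thesis .
qed

text \<open>Here \<open>C\<close> stands for an approximate inverse of both \<open>A\<close> and
  \<open>B\<close>. Counting on the side of the images puts both sets inside \<open>dom C\<close>. A
  value \<open>j\<close> in their overlap comes from the single point \<open>i\<close> with
  \<open>C j = Some i\<close>, where \<open>A\<close> and \<open>B\<close> agree.\<close>

lemma card_agree_left_inverse:
  assumes "finite (dom A)" "finite (dom B)" "finite (dom C)"
  shows "card {i. (C \<circ>\<^sub>m A) i = Some i} + card {i. (C \<circ>\<^sub>m B) i = Some i}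
    \<le> card (dom C) + card {i. A i = B i \<and> A i \<noteq> None}"
proof -
  define X Y where "X = {i. (C \<circ>\<^sub>m A) i = Some i}" and "Y = {i. (C \<circ>\<^sub>m B) i = Some i}"
  define X' Y' where "X' = {j. \<exists>i. A i = Some j \<and> C j = Some i}"
    and "Y' = {j. \<exists>i. B i = Some j \<and> C j = Some i}"
  let ?G = "{i. A i = B i \<and> A i \<noteq> None}"
  have sub: "X' \<subseteq> dom C" "Y' \<subseteq> dom C" by (auto simp: X'_def Y'_def)
  then have fin: "finite X'" "finite Y'" using assms(3) finite_subset by blast+
  have "X \<subseteq> (\<lambda>j. the (C j)) ` X'" "Y \<subseteq> (\<lambda>j. the (C j)) ` Y'"
    by (force simp: X_def Y_def X'_def Y'_def map_comp_Some_iff)+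
  then have "card X \<le> card X'" "card Y \<le> card Y'"
    using fin by (auto intro: surj_card_le)
  moreover have "card X' + card Y' = card (X' \<union> Y') + card (X' \<inter> Y')"
    using fin by (rule card_Un_Int)
  moreover have "card (X' \<union> Y') \<le> card (dom C)"
    using sub assms(3) by (intro card_mono) auto
  moreover have "X' \<inter> Y' \<subseteq> (\<lambda>i. the (A i)) ` ?G"
  proof
    fix j assume "j \<in> X' \<inter> Y'"
    then obtain i where "A i = Some j" "B i = Some j" by (auto simp: X'_def Y'_def)
    then show "j \<in> (\<lambda>i. the (A i)) ` ?G" by (intro image_eqI[of _ _ i]) auto
  qed
  then have "card (X' \<inter> Y') \<le> card ?G"
    using finite_agree[OF assms(1)] by (rule surj_card_le[rotated])
  ultimately show ?thesis unfolding X_def Y_def by linarith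
qed

text \<open>The mirror image of \<open>card_agree_left_inverse\<close>: one map \<open>A\<close> and
  two candidates for its inverse. If both undo \<open>A\<close> at \<open>i\<close>, they agree at
  the image of \<open>i\<close>. This compares two microstates at the inverse of a generator on
  which they coincide.\<close>

lemma card_agree_common_inverse:
  assumes "finite (dom A)" "finite (dom C)"
  shows "card {i. (C \<circ>\<^sub>m A) i = Some i} + card {i. (D \<circ>\<^sub>m A) i = Some i}
    \<le> card (dom A) + card {i. C i = D i \<and> C i \<noteq> None}"
proof -
  define X Y where "X = {i. (C \<circ>\<^sub>m A) i = Some i}" and "Y = {i. (D \<circ>\<^sub>m A) i = Some i}"
  let ?G = "{i. C i = D i \<and> C i \<noteq> None}"
  have sub: "X \<subseteq> dom A" "Y \<subseteq> dom A" by (auto simp: X_def Y_def map_comp_Some_iff)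
  then have fin: "finite X" "finite Y" using assms(1) finite_subset by blast+
  have "card X + card Y = card (X \<union> Y) + card (X \<inter> Y)"
    using fin by (rule card_Un_Int)
  moreover have "card (X \<union> Y) \<le> card (dom A)"
    using sub assms(1) by (intro card_mono) auto
  moreover have "X \<inter> Y \<subseteq> (\<lambda>j. the (C j)) ` ?G"
  proof
    fix i assume "i \<in> X \<inter> Y"
    then obtain j where "C j = Some i" "D j = Some i" by (auto simp: X_def Y_def map_comp_Some_iff)
    then show "i \<in> (\<lambda>j. the (C j)) ` ?G" by (intro image_eqI[of _ _ j]) auto
  qed
  then have "card (X \<inter> Y) \<le> card ?G"
    using finite_agree[OF assms(2)] by (rule surj_card_le[rotated])
  ultimately show ?thesis unfolding X_def Y_def by linarith
qed

text \<open>Inclusion-exclusion for the two domains, whose intersection contains the points of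
  agreement. The main estimates end here: a lower bound on agreement and upper bounds on the domains
  together bound the distance.\<close>

lemma card_differ_agree:
  assumes "finite (dom A)" "finite (dom B)"
  shows "card {i. A i \<noteq> B i} + 2 * card {i. A i = B i \<and> A i \<noteq> None} \<le> card (dom A) + card (dom B)"
proof -
  let ?G = "{i. A i = B i \<and> A i \<noteq> None}"
  have "card {i. A i \<noteq> B i} + card ?G = card ({i. A i \<noteq> B i} \<union> ?G)"
    using assms by (intro card_Un_disjoint[symmetric] finite_differ finite_agree) auto
  also have "{i. A i \<noteq> B i} \<union> ?G = dom A \<union> dom B" by (auto simp: dom_def)
  finally have "card {i. A i \<noteq> B i} + card ?G = card (dom A \<union> dom B)" .
  moreover have "card ?G \<le> card (dom A \<inter> dom B)"
    using assms by (intro card_mono) (auto, metis not_Some_eq)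
  moreover have "card (dom A) + card (dom B) = card (dom A \<union> dom B) + card (dom A \<inter> dom B)"
    using assms by (rule card_Un_Int)
  ultimately show ?thesis by linarith
qed

lemma card_dom_agree_differ:
  assumes "finite (dom A)" "finite (dom B)"
  shows "card (dom A) \<le> card {i. A i = B i \<and> A i \<noteq> None} + card {i. A i \<noteq> B i}"
proof -
  have "card (dom A) \<le> card ({i. A i = B i \<and> A i \<noteq> None} \<union> {i. A i \<noteq> B i})"
    using assms by (intro card_mono finite_UnI finite_differ finite_agree) auto
  also have "\<dots> \<le> card {i. A i = B i \<and> A i \<noteq> None} + card {i. A i \<noteq> B i}" by (rule card_Un_le)
  finally show ?thesis .
qed

lemma card_differ_triangle:
  assumes "finite (dom A)" "finite (dom B)" "finite (dom C)"
  shows "card {i. A i \<noteq> C i} \<le> card {i. A i \<noteq> B i} + card {i. B i \<noteq> C i}"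
proof -
  have "card {i. A i \<noteq> C i} \<le> card ({i. A i \<noteq> B i} \<union> {i. B i \<noteq> C i})"
    using assms by (intro card_mono finite_UnI finite_differ) auto
  also have "\<dots> \<le> card {i. A i \<noteq> B i} + card {i. B i \<noteq> C i}" by (rule card_Un_le)
  finally show ?thesis .
qed

lemma card_differ_sym: "card {i. A i \<noteq> B i} = card {i. B i \<noteq> A i}"
  by (rule arg_cong[of _ _ card]) auto

text \<open>The finite counterpart of \<open>udist_comp\<close>: injectivity of \<open>B\<close>
  ensures that pulling back the set where \<open>A\<close> and \<open>A'\<close> differ does not
  enlarge it.\<close>

lemma card_differ_comp:
  assumes "finite (dom A)" "finite (dom A')" "finite (dom B)" "finite (dom B')"
    and "inj_on B (dom B)"
  shows "card {i. (A \<circ>\<^sub>m B) i \<noteq> (A' \<circ>\<^sub>m B') i} \<le> card {i. A i \<noteq> A' i} + card {i. B i \<noteq> B' i}"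
proof -
  let ?X = "{i. \<exists>j. B i = Some j \<and> A j \<noteq> A' j}"
  have fin: "finite ?X" by (rule finite_subset[of _ "dom B"]) (use assms in auto)
  have "{i. (A \<circ>\<^sub>m B) i \<noteq> (A' \<circ>\<^sub>m B') i} \<subseteq> ?X \<union> {i. B i \<noteq> B' i}"
  proof
    fix i assume "i \<in> {i. (A \<circ>\<^sub>m B) i \<noteq> (A' \<circ>\<^sub>m B') i}"
    then show "i \<in> ?X \<union> {i. B i \<noteq> B' i}"
      by (cases "B i"; cases "B i = B' i") (auto simp: map_comp_def)
  qed
  then have "card {i. (A \<circ>\<^sub>m B) i \<noteq> (A' \<circ>\<^sub>m B') i} \<le> card (?X \<union> {i. B i \<noteq> B' i})"
    using assms fin by (intro card_mono finite_UnI finite_differ)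
  also have "\<dots> \<le> card ?X + card {i. B i \<noteq> B' i}" by (rule card_Un_le)
  also have "card ?X \<le> card {i. A i \<noteq> A' i}"
  proof (rule card_inj_on_le)
    have "x = x'" if "B x = Some y" "B x' = Some y" for x x' y
      using that assms(5) unfolding inj_on_dom_iff by blast
    then show "inj_on (\<lambda>i. the (B i)) ?X"
      by (intro inj_onI) auto
  qed (use assms finite_differ in auto)
  finally show ?thesis by simp
qed

text \<open>Where an injective \<open>P\<close> satisfies \<open>PP = P\<close> it is a partial identity, so there \<open>AP\<close> is a
  restriction of \<open>A\<close>.\<close>

lemma agree_restrict:
  fixes W W' A A' P P' :: "'a \<rightharpoonup> 'a"
  assumes "inj_on P (dom P)" "inj_on P' (dom P')"
  shows "{i. W i = W' i \<and> W i \<noteq> None} \<subseteq>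
    {i. A i = A' i \<and> A i \<noteq> None} \<inter> {i. P i = Some i} \<union>
    ({i. W i \<noteq> (A \<circ>\<^sub>m P) i} \<union> {i. W' i \<noteq> (A' \<circ>\<^sub>m P') i} \<union>
     ({i. P i \<noteq> (P \<circ>\<^sub>m P) i} \<union> {i. P' i \<noteq> (P' \<circ>\<^sub>m P') i}))"
proof
  fix i assume i: "i \<in> {i. W i = W' i \<and> W i \<noteq> None}"
  have *: "Q i = Some i \<and> B i = V i" if V: "V i = (B \<circ>\<^sub>m Q) i" "V i \<noteq> None"
    and Q: "Q i = (Q \<circ>\<^sub>m Q) i" "inj_on Q (dom Q)" for V B Q :: "'a \<rightharpoonup> 'a"
  proof -
    obtain k where "(B \<circ>\<^sub>m Q) i = Some k" using V by auto
    then obtain j where j: "Q i = Some j" "B j = Some k" by (auto simp: map_comp_Some_iff)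
    have "(Q \<circ>\<^sub>m Q) i = Q j" using j(1) by simp
    then have "Q j = Some j" using Q(1) j(1) by (rule trans[OF sym trans[OF sym]])
    then have "i = j" using Q(2) j(1) unfolding inj_on_dom_iff by blast
    then show ?thesis using V(1) j by simp
  qed
  show "i \<in> {i. A i = A' i \<and> A i \<noteq> None} \<inter> {i. P i = Some i} \<union>
    ({i. W i \<noteq> (A \<circ>\<^sub>m P) i} \<union> {i. W' i \<noteq> (A' \<circ>\<^sub>m P') i} \<union>
     ({i. P i \<noteq> (P \<circ>\<^sub>m P) i} \<union> {i. P' i \<noteq> (P' \<circ>\<^sub>m P') i}))"
  proof (cases "W i = (A \<circ>\<^sub>m P) i \<and> W' i = (A' \<circ>\<^sub>m P') i \<and>
      P i = (P \<circ>\<^sub>m P) i \<and> P' i = (P' \<circ>\<^sub>m P') i")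
    case True
    have W: "W i = W' i" "W i \<noteq> None" "W' i \<noteq> None" using i by (metis (mono_tags) mem_Collect_eq)+
    have "P i = Some i" "A i = W i" "A' i = W' i"
      using *[of W A P] *[of W' A' P'] True W assms by blast+
    then show ?thesis using W by simp
  next
    case False
    then show ?thesis by blast
  qed
qed

text \<open>To be read with \<open>A = \<phi> (s ++ t)\<close>, \<open>W = \<phi> s\<close>,
  \<open>V = \<phi> t\<close>, with \<open>P\<close> and \<open>Q\<close> the values at the domain
  projections of \<open>s\<close> and \<open>t\<close>, and primes for a second microstate. Up to
  defects, \<open>W\<close> and \<open>W'\<close> agree only where \<open>A\<close> and
  \<open>A'\<close> agree and \<open>P\<close> fixes the point; likewise for \<open>V\<close> and
  \<open>Q\<close>. A point fixed by both \<open>P\<close> and \<open>Q\<close> is fixed by their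
  product, so the overlap is bounded by a trace.\<close>

lemma card_agree_sum:
  fixes W W' V V' A A' P P' Q Q' :: "'a \<rightharpoonup> 'a"
  assumes fin: "finite (dom W)" "finite (dom W')" "finite (dom V)" "finite (dom V')"
    "finite (dom A)" "finite (dom A')" "finite (dom P)" "finite (dom P')"
    "finite (dom Q)" "finite (dom Q')"
    and inj: "inj_on P (dom P)" "inj_on P' (dom P')" "inj_on Q (dom Q)" "inj_on Q' (dom Q')"
  shows "card {i. W i = W' i \<and> W i \<noteq> None} + card {i. V i = V' i \<and> V i \<noteq> None} \<le>
    card {i. A i = A' i \<and> A i \<noteq> None} + card {i. (P \<circ>\<^sub>m Q) i = Some i} +
    (card {i. W i \<noteq> (A \<circ>\<^sub>m P) i} + card {i. W' i \<noteq> (A' \<circ>\<^sub>m P') i} +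
      (card {i. P i \<noteq> (P \<circ>\<^sub>m P) i} + card {i. P' i \<noteq> (P' \<circ>\<^sub>m P') i})) +
    (card {i. V i \<noteq> (A \<circ>\<^sub>m Q) i} + card {i. V' i \<noteq> (A' \<circ>\<^sub>m Q') i} +
      (card {i. Q i \<noteq> (Q \<circ>\<^sub>m Q) i} + card {i. Q' i \<noteq> (Q' \<circ>\<^sub>m Q') i}))"
proof -
  let ?G = "{i. A i = A' i \<and> A i \<noteq> None}"
  have part: "card {i. W i = W' i \<and> W i \<noteq> None} \<le> card (?G \<inter> {i. P i = Some i}) +
    (card {i. W i \<noteq> (A \<circ>\<^sub>m P) i} + card {i. W' i \<noteq> (A' \<circ>\<^sub>m P') i} +
      (card {i. P i \<noteq> (P \<circ>\<^sub>m P) i} + card {i. P' i \<noteq> (P' \<circ>\<^sub>m P') i}))"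
    if fin: "finite (dom W)" "finite (dom W')" "finite (dom P)" "finite (dom P')"
      and inj: "inj_on P (dom P)" "inj_on P' (dom P')" for W W' P P' :: "'a \<rightharpoonup> 'a"
  proof -
    have "card {i. W i = W' i \<and> W i \<noteq> None} \<le> card (?G \<inter> {i. P i = Some i} \<union>
    ({i. W i \<noteq> (A \<circ>\<^sub>m P) i} \<union> {i. W' i \<noteq> (A' \<circ>\<^sub>m P') i} \<union>
     ({i. P i \<noteq> (P \<circ>\<^sub>m P) i} \<union> {i. P' i \<noteq> (P' \<circ>\<^sub>m P') i})))"
      using that assms(5,6)
      by (intro card_mono agree_restrict finite_UnI finite_Int disjI1 finite_agree finite_differ
          finite_dom_comp)
    also have "\<dots> \<le> card (?G \<inter> {i. P i = Some i}) +
    (card {i. W i \<noteq> (A \<circ>\<^sub>m P) i} + card {i. W' i \<noteq> (A' \<circ>\<^sub>m P') i} +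
      (card {i. P i \<noteq> (P \<circ>\<^sub>m P) i} + card {i. P' i \<noteq> (P' \<circ>\<^sub>m P') i}))"
      by (intro order_trans[OF card_Un_le] add_mono order_refl)
    finally show ?thesis .
  qed
  have "card (?G \<inter> {i. P i = Some i}) + card (?G \<inter> {i. Q i = Some i}) =
    card (?G \<inter> {i. P i = Some i} \<union> ?G \<inter> {i. Q i = Some i}) +
    card ((?G \<inter> {i. P i = Some i}) \<inter> (?G \<inter> {i. Q i = Some i}))"
    using fin by (intro card_Un_Int finite_Int disjI1 finite_agree)
  also have "\<dots> \<le> card ?G + card {i. (P \<circ>\<^sub>m Q) i = Some i}"
    using fin by (intro add_mono card_mono finite_agree finite_fixpoints finite_dom_comp) auto
  finally show ?thesis
    using part[of W W' P P'] part[of V V' Q Q'] fin inj by linarith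
qed

section \<open>Partial permutations of \<open>{1..d}\<close>\<close>

lemma pperm_finite: "pperm d \<sigma> \<Longrightarrow> finite (dom \<sigma>)"
  unfolding pperm_def using finite_subset by blast

lemma pperm_inj: "pperm d \<sigma> \<Longrightarrow> inj_on \<sigma> (dom \<sigma>)"
  by (simp add: pperm_def)

lemma udist_d_eq:
  assumes "dom \<sigma> \<subseteq> {1..d}" "dom \<rho> \<subseteq> {1..d}"
  shows "udist_d d \<sigma> \<rho> = real (card {i. \<sigma> i \<noteq> \<rho> i}) / real d"
proof -
  have "i \<in> {1..d}" if "\<sigma> i \<noteq> \<rho> i" for i
    using assms that by (metis domIff subsetD)
  then have "{i \<in> {1..d}. \<sigma> i \<noteq> \<rho> i} = {i. \<sigma> i \<noteq> \<rho> i}" by auto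
  then show ?thesis by (simp add: udist_d_def)
qed

lemma tr_d_eq:
  assumes "dom \<sigma> \<subseteq> {1..d}"
  shows "tr_d d \<sigma> = real (card {i. \<sigma> i = Some i}) / real d"
proof -
  have "{i \<in> {1..d}. \<sigma> i = Some i} = {i. \<sigma> i = Some i}" using assms by auto
  then show ?thesis by (simp add: tr_d_def)
qed

lemma pperm_pid_d: "pperm d (pid_d d)"
  by (auto simp: pperm_def pid_d_def inj_on_def ran_def split: if_splits)

section \<open>Microstates\<close>

context pmp_relation
begin

lemma measure_dom_pinv: "pbij M R s \<Longrightarrow> measure M (dom (pinv s)) = measure M (dom s)"
proof -
  assume s: "pbij M R s"
  have "dom (pinv s) = ran s"
    using pinv_eq_Some_iff[OF pbij_inj[OF s]] by (auto simp: ran_def dom_def)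
  then show ?thesis using measure_ran[OF s] by simp
qed

text \<open>The product fixes exactly the points where \<open>s\<close> and \<open>t\<close> are
  both defined and agree. Agreement, and hence distance, thus becomes visible to the trace.\<close>

lemma trace_pinv_comp:
  assumes "pbij M R s"
  shows "trace M (pinv s \<circ>\<^sub>m t) = measure M {x. s x = t x \<and> s x \<noteq> None}"
proof -
  have "{x. (pinv s \<circ>\<^sub>m t) x = Some x} = {x. s x = t x \<and> s x \<noteq> None}"
    by (auto simp: map_comp_Some_iff pinv_eq_Some_iff[OF pbij_inj[OF assms]]) (metis not_Some_eq)
  then show ?thesis by (simp add: trace_def)
qed

lemma measure_dom_le_agree_udist:
  assumes "pbij M R s" "pbij M R t"
  shows "measure M (dom s) \<le> measure M {x. s x = t x \<and> s x \<noteq> None} + udist M s t"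
proof -
  have "measure M (dom s) \<le> measure M ({x. s x = t x \<and> s x \<noteq> None} \<union> {x. s x \<noteq> t x})"
    using assms by (intro finite_measure_mono sets.Un sets_agree sets_differ) auto
  also have "\<dots> \<le> measure M {x. s x = t x \<and> s x \<noteq> None} + udist M s t"
    unfolding udist_def using assms by (intro measure_Un_le sets_agree sets_differ)
  finally show ?thesis .
qed

lemma comp_source_proj: "pbij M R s \<Longrightarrow> s \<circ>\<^sub>m (pinv s \<circ>\<^sub>m s) = s"
  by (intro map_ext_Some)
    (auto simp: map_comp_Some_iff[of s "pinv s \<circ>\<^sub>m s"] pinv_comp_self_eq_Some_iff pbij_inj)

lemma source_proj_idem: "pbij M R s \<Longrightarrow> (pinv s \<circ>\<^sub>m s) \<circ>\<^sub>m (pinv s \<circ>\<^sub>m s) = pinv s \<circ>\<^sub>m s"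
  by (simp add: map_comp_assoc comp_source_proj)

context
  fixes F :: "('a \<rightharpoonup> 'a) set"
  assumes F: "F \<subseteq> {s. pbij M R s}"
begin

lemma SigmaPow_mono_double: "2 * m \<le> N \<Longrightarrow> s \<in> SigmaPow M R F m \<Longrightarrow> s \<in> SigmaPow M R F N"
  using SigmaPow_mono[OF F, of m N s] by simp

lemma SigmaPow_comp_double:
  "2 * m \<le> N \<Longrightarrow> s \<in> SigmaPow M R F m \<Longrightarrow> t \<in> SigmaPow M R F m \<Longrightarrow> s \<circ>\<^sub>m t \<in> SigmaPow M R F N"
  using SigmaPow_mono[OF F, of "m + m" N] SigmaPow_comp[OF F, of s m t m] by simp

lemma SA_mono:
  assumes "m \<le> n" "\<delta> \<le> \<delta>'"
  shows "SA M R F n \<delta> d \<subseteq> SA M R F m \<delta>' d"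
proof
  fix \<phi> assume \<phi>: "\<phi> \<in> SA M R F n \<delta> d"
  note mono = SigmaPow_mono[OF F assms(1)]
  have "udist_d d (\<phi> (s \<circ>\<^sub>m t)) (\<phi> s \<circ>\<^sub>m \<phi> t) < \<delta>'"
    if "s \<in> SigmaPow M R F m" "t \<in> SigmaPow M R F m" "s \<circ>\<^sub>m t \<in> SigmaPow M R F m" for s t
    using \<phi> that[THEN mono] assms(2) unfolding SA_def by fastforce
  moreover have "\<bar>tr_d d (\<phi> s) - trace M s\<bar> < \<delta>'" if "s \<in> SigmaPow M R F m" for s
    using \<phi> that[THEN mono] assms(2) unfolding SA_def by fastforce
  ultimately show "\<phi> \<in> SA M R F m \<delta>' d"
    using \<phi> unfolding SA_def mem_Collect_eq by blast
qed

section \<open>Estimates for a single microstate\<close>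

context
  fixes \<phi> :: "('a \<rightharpoonup> 'a) \<Rightarrow> nat \<rightharpoonup> nat" and N :: nat and \<delta> :: real and d :: nat
  assumes SA: "\<phi> \<in> SA M R F N \<delta> d" and d: "0 < d"
begin

lemma SA_pperm: "pbij M R s \<Longrightarrow> pperm d (\<phi> s)"
  using SA by (simp add: SA_def)

lemma SA_finite: "pbij M R s \<Longrightarrow> finite (dom (\<phi> s))"
  using SA_pperm pperm_finite by blast

lemma SA_AE: "pbij M R s \<Longrightarrow> pbij M R t \<Longrightarrow> AE x in M. s x = t x \<Longrightarrow> \<phi> s = \<phi> t"
  using SA by (simp add: SA_def)

text \<open>The condition in \<open>SA\<close> is rescaled to a count and weakened to a non-strict
  inequality, so that the later estimates add up as linear inequalities.\<close>

lemma SA_mult: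
  assumes "s \<in> SigmaPow M R F N" "t \<in> SigmaPow M R F N" "s \<circ>\<^sub>m t \<in> SigmaPow M R F N"
  shows "real (card {i. \<phi> (s \<circ>\<^sub>m t) i \<noteq> (\<phi> s \<circ>\<^sub>m \<phi> t) i}) \<le> \<delta> * d"
proof -
  have p: "pperm d (\<phi> s)" "pperm d (\<phi> t)" "pperm d (\<phi> (s \<circ>\<^sub>m t))"
    using assms SigmaPow_pbij[OF F] SA_pperm by blast+
  have "dom (\<phi> s \<circ>\<^sub>m \<phi> t) \<subseteq> dom (\<phi> t)" by (auto simp: map_comp_Some_iff)
  then have "udist_d d (\<phi> (s \<circ>\<^sub>m t)) (\<phi> s \<circ>\<^sub>m \<phi> t)
      = real (card {i. \<phi> (s \<circ>\<^sub>m t) i \<noteq> (\<phi> s \<circ>\<^sub>m \<phi> t) i}) / real d"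
    using p unfolding pperm_def by (intro udist_d_eq) blast+
  moreover have "udist_d d (\<phi> (s \<circ>\<^sub>m t)) (\<phi> s \<circ>\<^sub>m \<phi> t) < \<delta>"
    using SA assms by (simp add: SA_def)
  ultimately have "real (card {i. \<phi> (s \<circ>\<^sub>m t) i \<noteq> (\<phi> s \<circ>\<^sub>m \<phi> t) i}) / real d < \<delta>" by simp
  then show ?thesis using d by (simp add: pos_divide_less_eq)
qed

lemma SA_trace:
  assumes "s \<in> SigmaPow M R F N"
  shows "real (card {i. \<phi> s i = Some i}) \<le> (trace M s + \<delta>) * d"
    and "(trace M s - \<delta>) * d \<le> real (card {i. \<phi> s i = Some i})"
proof -
  have "tr_d d (\<phi> s) = real (card {i. \<phi> s i = Some i}) / real d"
    using SA_pperm[OF SigmaPow_pbij[OF F assms]] by (intro tr_d_eq) (auto simp: pperm_def)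
  moreover have "\<bar>tr_d d (\<phi> s) - trace M s\<bar> < \<delta>"
    using SA assms by (simp add: SA_def)
  ultimately have *: "\<bar>real (card {i. \<phi> s i = Some i}) / real d - trace M s\<bar> < \<delta>" by simp
  have "real (card {i. \<phi> s i = Some i}) / real d \<le> trace M s + \<delta>"
    "trace M s - \<delta> \<le> real (card {i. \<phi> s i = Some i}) / real d"
    using * by linarith+
  then show "real (card {i. \<phi> s i = Some i}) \<le> (trace M s + \<delta>) * d"
    "(trace M s - \<delta>) * d \<le> real (card {i. \<phi> s i = Some i})"
    using d by (simp_all add: pos_divide_le_eq pos_le_divide_eq)
qed

lemma SA_trace_comp:
  assumes "s \<in> SigmaPow M R F N" "t \<in> SigmaPow M R F N" "s \<circ>\<^sub>m t \<in> SigmaPow M R F N"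
  shows "real (card {i. (\<phi> s \<circ>\<^sub>m \<phi> t) i = Some i}) \<le> (trace M (s \<circ>\<^sub>m t) + 2 * \<delta>) * d"
    and "(trace M (s \<circ>\<^sub>m t) - 2 * \<delta>) * d \<le> real (card {i. (\<phi> s \<circ>\<^sub>m \<phi> t) i = Some i})"
proof -
  have fin: "finite (dom (\<phi> (s \<circ>\<^sub>m t)))" "finite (dom (\<phi> s \<circ>\<^sub>m \<phi> t))"
    using assms SigmaPow_pbij[OF F] SA_finite by (blast intro: finite_dom_comp)+
  note * = SA_mult[OF assms] SA_trace[OF assms(3)]
    card_fixpoints_le[OF fin] card_fixpoints_le[OF fin(2,1)]
    card_differ_sym[of "\<phi> (s \<circ>\<^sub>m t)" "\<phi> s \<circ>\<^sub>m \<phi> t"]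
  show "real (card {i. (\<phi> s \<circ>\<^sub>m \<phi> t) i = Some i}) \<le> (trace M (s \<circ>\<^sub>m t) + 2 * \<delta>) * d"
    "(trace M (s \<circ>\<^sub>m t) - 2 * \<delta>) * d \<le> real (card {i. (\<phi> s \<circ>\<^sub>m \<phi> t) i = Some i})"
    using * by (simp_all add: algebra_simps)
qed

context
  fixes m :: nat
  assumes N: "2 * m \<le> N"
begin

text \<open>The projection \<open>p\<close> onto the domain of \<open>s\<close> satisfies
  \<open>pp = p\<close> and \<open>sp = s\<close>. The error 3\<delta> consists of one \<delta> each
  for the trace of \<open>p\<close>, the defect of idempotence and the defect in
  \<open>sp = s\<close>.\<close>

lemma SA_card_dom_le:
  assumes "s \<in> SigmaPow M R F m"
  shows "real (card (dom (\<phi> s))) \<le> (measure M (dom s) + 3 * \<delta>) * d"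
proof -
  let ?p = "pinv s \<circ>\<^sub>m s"
  have s: "pbij M R s" using SigmaPow_pbij[OF F assms] .
  have p: "?p \<in> SigmaPow M R F N" using assms by (intro SigmaPow_comp_double[OF N] SigmaPow_pinv[OF F])
  have pp: "pbij M R ?p" using SigmaPow_pbij[OF F p] .
  have "{x. s x = s x \<and> s x \<noteq> None} = dom s" by auto
  then have "trace M ?p = measure M (dom s)" using trace_pinv_comp[OF s, of s] by simp
  then have "real (card {i. \<phi> ?p i = Some i}) \<le> (measure M (dom s) + \<delta>) * d"
    using SA_trace(1)[OF p] by simp
  moreover have "real (card {i. \<phi> ?p i \<noteq> (\<phi> ?p \<circ>\<^sub>m \<phi> ?p) i}) \<le> \<delta> * d"
    using SA_mult[OF p p] p by (simp add: source_proj_idem[OF s])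
  moreover have "real (card {i. \<phi> s i \<noteq> (\<phi> s \<circ>\<^sub>m \<phi> ?p) i}) \<le> \<delta> * d"
    using SA_mult[OF SigmaPow_mono_double[OF N assms] p] SigmaPow_mono_double[OF N assms] by (simp add: comp_source_proj[OF s])
  moreover have "card (dom (\<phi> ?p)) \<le> card {i. \<phi> ?p i = Some i} + card {i. \<phi> ?p i \<noteq> (\<phi> ?p \<circ>\<^sub>m \<phi> ?p) i}"
    using SA_pperm[OF pp] by (intro card_dom_le_fixpoints pperm_finite pperm_inj)
  moreover have "card (dom (\<phi> s)) \<le> card (dom (\<phi> ?p)) + card {i. \<phi> s i \<noteq> (\<phi> s \<circ>\<^sub>m \<phi> ?p) i}"
    using SA_finite s pp by (intro card_dom_le_comp)
  ultimately show ?thesis by (simp add: algebra_simps)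
qed

lemma SA_card_fix_pinv_comp:
  assumes "s \<in> SigmaPow M R F m" "t \<in> SigmaPow M R F m"
  shows "(measure M {x. s x = t x \<and> s x \<noteq> None} - 2 * \<delta>) * d
    \<le> real (card {i. (\<phi> (pinv s) \<circ>\<^sub>m \<phi> t) i = Some i})"
proof -
  have "(trace M (pinv s \<circ>\<^sub>m t) - 2 * \<delta>) * d \<le> real (card {i. (\<phi> (pinv s) \<circ>\<^sub>m \<phi> t) i = Some i})"
    using assms SigmaPow_pinv[OF F] by (intro SA_trace_comp SigmaPow_mono_double[OF N] SigmaPow_comp_double[OF N]) auto
  then show ?thesis by (simp add: trace_pinv_comp[OF SigmaPow_pbij[OF F assms(1)]])
qed

lemma SA_card_fix_pinv_comp_self:
  assumes "s \<in> SigmaPow M R F m"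
  shows "(measure M (dom s) - 2 * \<delta>) * d \<le> real (card {i. (\<phi> (pinv s) \<circ>\<^sub>m \<phi> s) i = Some i})"
proof -
  have "{x. s x = s x \<and> s x \<noteq> None} = dom s" by auto
  then show ?thesis using SA_card_fix_pinv_comp[OF assms assms] by simp
qed

lemma SA_card_dom_ge:
  assumes "s \<in> SigmaPow M R F m"
  shows "(measure M (dom s) - 2 * \<delta>) * d \<le> real (card (dom (\<phi> s)))"
proof -
  have "card {i. (\<phi> (pinv s) \<circ>\<^sub>m \<phi> s) i = Some i} \<le> card (dom (\<phi> s))"
    using SA_finite[OF SigmaPow_pbij[OF F assms]]
    by (intro card_mono) (auto simp: map_comp_Some_iff)
  then show ?thesis using SA_card_fix_pinv_comp_self[OF assms] by linarith
qed

text \<open>The approximate left inverse \<open>\<phi> (pinv a)\<close> has a domain of size about \<open>\<mu> (dom a)\<close>,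
  and it undoes both \<open>\<phi> a\<close> and \<open>\<phi> b\<close> on almost that many points.\<close>

lemma SA_continuous:
  assumes "a \<in> SigmaPow M R F m" "b \<in> SigmaPow M R F m"
  shows "real (card {i. \<phi> a i \<noteq> \<phi> b i}) \<le> (2 * udist M a b + 20 * \<delta>) * d"
proof -
  have ab: "pbij M R a" "pbij M R b" "pbij M R (pinv a)"
    using assms SigmaPow_pbij[OF F] pbij_pinv by blast+
  define u where "u = measure M {x. a x = b x \<and> a x \<noteq> None}"
  have "measure M {x. b x = a x \<and> b x \<noteq> None} = u"
    unfolding u_def by (rule arg_cong[of _ _ "measure M"]) (metis (lifting))
  then have "measure M (dom a) \<le> u + udist M a b" "measure M (dom b) \<le> u + udist M a b"
    using measure_dom_le_agree_udist[OF ab(1,2)] measure_dom_le_agree_udist[OF ab(2,1)]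
    by (simp_all add: u_def udist_sym)
  then have m: "measure M (dom a) * d \<le> (u + udist M a b) * d" "measure M (dom b) * d \<le> (u + udist M a b) * d"
    using d by (simp_all add: mult_right_mono)
  \<comment> \<open>Per unit of \<open>d\<close>, the number of points of agreement is at least
    \<open>u\<close> - 7\<delta>: the two fixed point counts lose 2\<delta> each, and the domain of
    \<open>\<phi> (pinv a)\<close> exceeds its expected size by at most 3\<delta>. Doubling this and
    adding 3\<delta> for each of the two domains gives 20\<delta>.\<close>
  have "real (card (dom (\<phi> (pinv a)))) \<le> (measure M (dom a) + 3 * \<delta>) * d"
    using SA_card_dom_le[OF SigmaPow_pinv[OF F assms(1)]] by (simp add: measure_dom_pinv ab)
  moreover note SA_card_dom_le[OF assms(1)] SA_card_dom_le[OF assms(2)]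
    SA_card_fix_pinv_comp_self[OF assms(1)]
    SA_card_fix_pinv_comp[OF assms, folded u_def]
    card_agree_left_inverse[OF SA_finite[OF ab(1)] SA_finite[OF ab(2)] SA_finite[OF ab(3)]]
    card_differ_agree[OF SA_finite[OF ab(1)] SA_finite[OF ab(2)]]
  ultimately show ?thesis using m by (simp add: algebra_simps)
qed

end

end

text \<open>\<open>N\<close> and \<open>C\<close> are fixed before \<delta>, \<open>d\<close> and
  the two microstates. With a bound linear in \<delta>, the tolerance can later be chosen after
  \<open>t\<close>, to make the error as small as desired.\<close>

definition determined :: "nat \<Rightarrow> real \<Rightarrow> ('a \<rightharpoonup> 'a) \<Rightarrow> bool" where
  "determined N C t \<longleftrightarrow> (\<forall>\<delta> d \<phi> \<psi>. 0 < \<delta> \<longrightarrow> 0 < d \<longrightarrow> \<phi> \<in> SA M R F N \<delta> d \<longrightarrow>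
    \<psi> \<in> SA M R F N \<delta> d \<longrightarrow> (\<forall>f\<in>F. \<phi> f = \<psi> f) \<longrightarrow>
    real (card {i. \<phi> t i \<noteq> \<psi> t i}) \<le> C * \<delta> * d)"

lemma determined_mono:
  assumes "determined N C t" "N \<le> N'" "C \<le> C'"
  shows "determined N' C' t"
  unfolding determined_def
proof (intro allI impI)
  fix \<delta> :: real and d :: nat and \<phi> \<psi>
  assume *: "0 < \<delta>" "0 < d" "\<phi> \<in> SA M R F N' \<delta> d" "\<psi> \<in> SA M R F N' \<delta> d" "\<forall>f\<in>F. \<phi> f = \<psi> f"
  then have "\<phi> \<in> SA M R F N \<delta> d" "\<psi> \<in> SA M R F N \<delta> d"
    using SA_mono[OF assms(2) order_refl] by blast+
  then have "real (card {i. \<phi> t i \<noteq> \<psi> t i}) \<le> C * \<delta> * d"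
    using assms(1) * unfolding determined_def by blast
  also have "\<dots> \<le> C' * \<delta> * d"
    using assms(3) * by (intro mult_right_mono) auto
  finally show "real (card {i. \<phi> t i \<noteq> \<psi> t i}) \<le> C' * \<delta> * d" .
qed

lemma determined_AE:
  assumes "determined N C t" "pbij M R s" "pbij M R t" "AE x in M. s x = t x"
  shows "determined N C s"
  unfolding determined_def
proof (intro allI impI)
  fix \<delta> :: real and d :: nat and \<phi> \<psi>
  assume *: "0 < \<delta>" "0 < d" "\<phi> \<in> SA M R F N \<delta> d" "\<psi> \<in> SA M R F N \<delta> d" "\<forall>f\<in>F. \<phi> f = \<psi> f"
  have "\<phi> s = \<phi> t" "\<psi> s = \<psi> t"
    using SA_AE[OF *(3,2) assms(2-4)] SA_AE[OF *(4,2) assms(2-4)] .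
  then show "real (card {i. \<phi> s i \<noteq> \<psi> s i}) \<le> C * \<delta> * d"
    using * assms(1) unfolding determined_def by simp
qed

lemma determined_pid: "determined N 0 (pid M)"
  unfolding determined_def SA_def by auto

lemma determined_generator: "f \<in> F \<Longrightarrow> determined N 0 f"
  unfolding determined_def by auto

text \<open>Both \<open>\<phi> (pinv f)\<close> and \<open>\<psi> (pinv f)\<close> nearly invert the
  same map \<open>\<phi> f = \<psi> f\<close>. Level 2 accommodates the product of \<open>f\<close>
  with its inverse. The constant is 2 * 7 from the points of agreement plus 2 * 3 from the two
  domains.\<close>

lemma determined_pinv_generator:
  assumes "f \<in> F"
  shows "determined 2 20 (pinv f)"
  unfolding determined_def
proof (intro allI impI)
  fix \<delta> :: real and d :: nat and \<phi> \<psi>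
  assume *: "0 < \<delta>" "0 < d" "\<phi> \<in> SA M R F 2 \<delta> d" "\<psi> \<in> SA M R F 2 \<delta> d" "\<forall>f\<in>F. \<phi> f = \<psi> f"
  have f: "f \<in> SigmaPow M R F 1" using subset_SigmaPow_one[OF F] assms by blast
  have p: "pbij M R f" "pbij M R (pinv f)" using F assms pbij_pinv by blast+
  have two: "2 * (1::nat) \<le> 2" by simp
  note \<phi> = *(3,2) and \<psi> = *(4,2)
  have eq: "\<psi> f = \<phi> f" using *(5) assms by simp
  note SA_card_dom_le[OF \<phi> two f] SA_card_fix_pinv_comp_self[OF \<phi> two f]
    SA_card_fix_pinv_comp_self[OF \<psi> two f, unfolded eq]
    SA_card_dom_le[OF \<phi> two SigmaPow_pinv[OF F f], unfolded measure_dom_pinv[OF p(1)]]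
    SA_card_dom_le[OF \<psi> two SigmaPow_pinv[OF F f], unfolded measure_dom_pinv[OF p(1)]]
    card_agree_common_inverse[OF SA_finite[OF \<phi> p(1)] SA_finite[OF \<phi> p(2)], of "\<psi> (pinv f)"]
    card_differ_agree[OF SA_finite[OF \<phi> p(2)] SA_finite[OF \<psi> p(2)]]
  then show "real (card {i. \<phi> (pinv f) i \<noteq> \<psi> (pinv f) i}) \<le> 20 * \<delta> * d"
    by (simp add: algebra_simps)
qed

text \<open>Each factor contributes \<open>C\<close>, and the product rule is applied once in each
  microstate.\<close>

lemma determined_comp:
  assumes s: "s \<in> SigmaPow M R F m" "determined N C s"
    and t: "t \<in> SigmaPow M R F m" "determined N C t"
    and N: "2 * m \<le> N"
  shows "determined N (2 * C + 2) (s \<circ>\<^sub>m t)"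
  unfolding determined_def
proof (intro allI impI)
  fix \<delta> :: real and d :: nat and \<phi> \<psi>
  assume *: "0 < \<delta>" "0 < d" "\<phi> \<in> SA M R F N \<delta> d" "\<psi> \<in> SA M R F N \<delta> d" "\<forall>f\<in>F. \<phi> f = \<psi> f"
  note \<phi> = *(3,2) and \<psi> = *(4,2)
  have p: "pbij M R s" "pbij M R t" "pbij M R (s \<circ>\<^sub>m t)"
    using s t SigmaPow_pbij[OF F] pbij_comp by blast+
  have mem: "s \<in> SigmaPow M R F N" "t \<in> SigmaPow M R F N" "s \<circ>\<^sub>m t \<in> SigmaPow M R F N"
    using s t SigmaPow_mono_double[OF N] SigmaPow_comp_double[OF N] by blast+
  note fin = SA_finite[OF \<phi> p(1)] SA_finite[OF \<phi> p(2)] SA_finite[OF \<phi> p(3)]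
    SA_finite[OF \<psi> p(1)] SA_finite[OF \<psi> p(2)] SA_finite[OF \<psi> p(3)]
  have "real (card {i. \<phi> s i \<noteq> \<psi> s i}) \<le> C * \<delta> * d" "real (card {i. \<phi> t i \<noteq> \<psi> t i}) \<le> C * \<delta> * d"
    using s(2) t(2) * unfolding determined_def by blast+
  moreover note SA_mult[OF \<phi> mem] SA_mult[OF \<psi> mem]
    card_differ_comp[OF fin(1,4,2,5) pperm_inj[OF SA_pperm[OF \<phi> p(2)]]]
    card_differ_triangle[OF fin(3) finite_dom_comp[OF fin(2), of "\<phi> s"] fin(6)]
    card_differ_triangle[OF finite_dom_comp[OF fin(2), of "\<phi> s"] finite_dom_comp[OF fin(5), of "\<psi> s"] fin(6)]
    card_differ_sym[of "\<psi> (s \<circ>\<^sub>m t)" "\<psi> s \<circ>\<^sub>m \<psi> t"]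
  ultimately show "real (card {i. \<phi> (s \<circ>\<^sub>m t) i \<noteq> \<psi> (s \<circ>\<^sub>m t) i}) \<le> (2 * C + 2) * \<delta> * d"
    by (simp add: algebra_simps)
qed

text \<open>\<open>SA\<close> contains no additivity, so \<open>s\<close> and \<open>t\<close> are
  regained from \<open>s ++ t\<close> as products with the projections onto their domains. The
  points where the two microstates agree on \<open>s\<close> and on \<open>t\<close> transfer to
  \<open>s ++ t\<close> with little double counting, and much agreement there means small
  distance.\<close>

lemma determined_add:
  assumes s: "s \<in> SigmaPow M R F m" "determined N C s"
    and t: "t \<in> SigmaPow M R F m" "determined N C t"
    and u: "orth s t" "s ++ t \<in> SigmaPow M R F m"
    and N: "2 * m \<le> N"
  shows "determined N (4 * C + 34) (s ++ t)"
  unfolding determined_def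
proof (intro allI impI)
  fix \<delta> :: real and d :: nat and \<phi> \<psi>
  assume *: "0 < \<delta>" "0 < d" "\<phi> \<in> SA M R F N \<delta> d" "\<psi> \<in> SA M R F N \<delta> d" "\<forall>f\<in>F. \<phi> f = \<psi> f"
  note \<phi> = *(3,2) and \<psi> = *(4,2)
  have N2: "2 * m \<le> N" using N by simp
  define p q where "p = pinv s \<circ>\<^sub>m s" and "q = pinv t \<circ>\<^sub>m t"
  have ps: "pbij M R s" and pt: "pbij M R t" and pu: "pbij M R (s ++ t)"
    using s t u SigmaPow_pbij[OF F] by blast+
  have dj: "dom s \<inter> dom t = {}" using u by (simp add: orth_def)
  have p_iff: "p x = Some y \<longleftrightarrow> x = y \<and> x \<in> dom s" and q_iff: "q x = Some y \<longleftrightarrow> x = y \<and> x \<in> dom t"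
    for x y
    unfolding p_def q_def using ps pt by (simp_all add: pinv_comp_self_eq_Some_iff pbij_inj)
  have up: "(s ++ t) \<circ>\<^sub>m p = s"
    using dj by (intro map_ext_Some)
      (auto simp: map_comp_Some_iff p_iff map_add_eq_Some_iff[OF dj] simp del: map_add_Some_iff)
  have uq: "(s ++ t) \<circ>\<^sub>m q = t"
    using dj by (intro map_ext_Some)
      (auto simp: map_comp_Some_iff q_iff map_add_eq_Some_iff[OF dj] simp del: map_add_Some_iff)
  have pq: "p \<circ>\<^sub>m q = Map.empty"
    using dj by (intro map_ext_Some) (auto simp: map_comp_Some_iff p_iff q_iff)
  have pp: "p \<circ>\<^sub>m p = p" and qq: "q \<circ>\<^sub>m q = q"
    unfolding p_def q_def using ps pt source_proj_idem by blast+
  have mem: "s \<in> SigmaPow M R F N" "t \<in> SigmaPow M R F N" "s ++ t \<in> SigmaPow M R F N"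
    "p \<in> SigmaPow M R F N" "q \<in> SigmaPow M R F N"
    using s t u SigmaPow_mono_double[OF N2] SigmaPow_comp_double[OF N2] SigmaPow_pinv[OF F]
    unfolding p_def q_def by blast+
  have pbp: "pbij M R p" and pbq: "pbij M R q" using mem SigmaPow_pbij[OF F] by blast+
  \<comment> \<open>Disjointness of the domains reaches the microstate as a vanishing trace: few
    points are fixed by both projections.\<close>
  have "trace M (p \<circ>\<^sub>m q) = 0" by (simp add: pq trace_def)
  then have PQ: "real (card {i. (\<phi> p \<circ>\<^sub>m \<phi> q) i = Some i}) \<le> 2 * \<delta> * d"
    using SA_trace_comp(1)[OF \<phi> mem(4,5)] SigmaPow_empty[OF F] by (simp add: pq)
  have mult: "real (card {i. \<theta> s i \<noteq> (\<theta> (s ++ t) \<circ>\<^sub>m \<theta> p) i}) \<le> \<delta> * d"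
    "real (card {i. \<theta> t i \<noteq> (\<theta> (s ++ t) \<circ>\<^sub>m \<theta> q) i}) \<le> \<delta> * d"
    "real (card {i. \<theta> p i \<noteq> (\<theta> p \<circ>\<^sub>m \<theta> p) i}) \<le> \<delta> * d"
    "real (card {i. \<theta> q i \<noteq> (\<theta> q \<circ>\<^sub>m \<theta> q) i}) \<le> \<delta> * d"
    if "\<theta> \<in> SA M R F N \<delta> d" for \<theta>
    using SA_mult[OF that *(2) mem(3,4)] SA_mult[OF that *(2) mem(3,5)]
      SA_mult[OF that *(2) mem(4,4)] SA_mult[OF that *(2) mem(5,5)] mem up uq pp qq by simp_all
  have det: "real (card {i. \<phi> s i \<noteq> \<psi> s i}) \<le> C * \<delta> * d" "real (card {i. \<phi> t i \<noteq> \<psi> t i}) \<le> C * \<delta> * d"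
    using s(2) t(2) * unfolding determined_def by blast+
  have "measure M (dom (s ++ t)) = measure M (dom s) + measure M (dom t)"
    using dj pbij_dom[OF ps] pbij_dom[OF pt] by (simp add: finite_measure_Union Un_commute)
  then have dom_u: "measure M (dom (s ++ t)) * d = measure M (dom s) * d + measure M (dom t) * d"
    by (simp add: algebra_simps)
  note fin = SA_finite[OF \<phi>] SA_finite[OF \<psi>] and inj = pperm_inj[OF SA_pperm[OF \<phi>]] pperm_inj[OF SA_pperm[OF \<psi>]]
  let ?G = "\<lambda>t. real (card {i. \<phi> t i = \<psi> t i \<and> \<phi> t i \<noteq> None})"
  have "?G s \<ge> (measure M (dom s) - 2 * \<delta>) * d - C * \<delta> * d"
    using SA_card_dom_ge[OF \<phi> N2 s(1)] det(1) card_dom_agree_differ[OF fin(1)[OF ps] fin(2)[OF ps]] by linarith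
  moreover have "?G t \<ge> (measure M (dom t) - 2 * \<delta>) * d - C * \<delta> * d"
    using SA_card_dom_ge[OF \<phi> N2 t(1)] det(2) card_dom_agree_differ[OF fin(1)[OF pt] fin(2)[OF pt]] by linarith
  \<comment> \<open>The error 10 is 2 for the fixed points of the product of the projections plus 1
    for each of the four product rules in both microstates. With 2C + 4 lost in the two lower bounds
    and 6 in the two domains, the total is 2(2C + 4 + 10) + 6 = 4C + 34.\<close>
  moreover have "?G s + ?G t \<le> ?G (s ++ t) + 10 * \<delta> * d"
    using card_agree_sum[OF fin(1)[OF ps] fin(2)[OF ps] fin(1)[OF pt] fin(2)[OF pt]
        fin(1)[OF pu] fin(2)[OF pu] fin(1)[OF pbp] fin(2)[OF pbp] fin(1)[OF pbq] fin(2)[OF pbq]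
        inj(1)[OF pbp] inj(2)[OF pbp] inj(1)[OF pbq] inj(2)[OF pbq]]
      PQ mult[OF *(3)] mult[OF *(4)] by linarith
  moreover note SA_card_dom_le[OF \<phi> N2 u(2)] SA_card_dom_le[OF \<psi> N2 u(2)]
    card_differ_agree[OF fin(1)[OF pu] fin(2)[OF pu]]
  ultimately show "real (card {i. \<phi> (s ++ t) i \<noteq> \<psi> (s ++ t) i}) \<le> (4 * C + 34) * \<delta> * d"
    using dom_u by (simp add: algebra_simps)
qed

lemma determined_common:
  assumes "determined N C s" "determined N' C' t"
  obtains N'' C'' where "k \<le> N''" "determined N'' C'' s" "determined N'' C'' t"
proof
  show "k \<le> max k (max N N')" by simp
  show "determined (max k (max N N')) (max C C') s" "determined (max k (max N N')) (max C C') t"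
    using determined_mono assms by (auto simp: le_max_iff_disj)
qed

lemma determined_prods:
  "w \<in> prods M (Fpm M F) n \<Longrightarrow> \<exists>N C. determined N C w"
proof (induction n arbitrary: w)
  case 0
  then show ?case using determined_pid by auto
next
  case (Suc n)
  then obtain s t where st: "w = s \<circ>\<^sub>m t" "s \<in> Fpm M F" "t \<in> prods M (Fpm M F) n" by auto
  have "\<exists>N C. determined N C s"
    using st(2) determined_pid determined_generator determined_pinv_generator
    unfolding Fpm_def by blast
  moreover have "\<exists>N C. determined N C t" using Suc.IH st by blast
  ultimately obtain N C where NC: "2 * (n + 1) \<le> N" "determined N C s" "determined N C t"
    using determined_common[of _ _ s _ _ t "2 * (n + 1)"] by metis
  have "s \<in> SigmaPow M R F (n + 1)" "t \<in> SigmaPow M R F (n + 1)"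
    using prods_SigmaPow[OF F prods_one[OF st(2)]] prods_SigmaPow[OF F st(3)]
      SigmaPow_mono[OF F, of 1 "n + 1"] SigmaPow_mono[OF F, of n "n + 1"] by auto
  then show ?case using NC determined_comp st(1) by blast
qed

lemma determined_SigmaPow:
  assumes "t \<in> SigmaPow M R F n"
  shows "\<exists>N C. determined N C t"
proof -
  obtain t' where t': "t' \<in> osums (words F n)" "AE x in M. t x = t' x"
    using assms unfolding SigmaPow_def aeclose_def[of M R "osums _"] by auto
  from t'(1) have "\<exists>N C. determined N C t'"
  proof (induction rule: osums_induct)
    case empty
    \<comment> \<open>A microstate may send the empty map to a nonempty one, but on a domain of at
      most 3\<delta>d points. The constant 6 would do; 34 is slack.\<close>
    have "determined 1 34 Map.empty"
      unfolding determined_def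
    proof (intro allI impI)
      fix \<delta> :: real and d :: nat and \<phi> \<psi>
      assume *: "0 < \<delta>" "0 < d" "\<phi> \<in> SA M R F 1 \<delta> d" "\<psi> \<in> SA M R F 1 \<delta> d" "\<forall>f\<in>F. \<phi> f = \<psi> f"
      have e: "Map.empty \<in> SigmaPow M R F 0" using SigmaPow_empty[OF F] .
      have "real (card (dom (\<phi> Map.empty))) \<le> 3 * \<delta> * d" "real (card (dom (\<psi> Map.empty))) \<le> 3 * \<delta> * d"
        using SA_card_dom_le[OF *(3,2) _ e] SA_card_dom_le[OF *(4,2) _ e] by simp_all
      then show "real (card {i. \<phi> Map.empty i \<noteq> \<psi> Map.empty i}) \<le> 34 * \<delta> * d"
        using card_differ_agree[OF SA_finite[OF *(3,2) pbij_empty] SA_finite[OF *(4,2) pbij_empty]]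
          mult_nonneg_nonneg[of \<delta> d] *(1) by linarith
    qed
    then show ?case by blast
  next
    case (add s t)
    obtain w where w: "pbij M R s" "w \<in> prods M (Fpm M F) n" "AE x in M. s x = w x"
      using add.hyps unfolding aeclose_def by blast
    have "pbij M R w" using w(2) prods_pbij[OF Fpm_pbij[OF F]] by blast
    then have "\<exists>N C. determined N C s"
      using determined_prods[OF w(2)] determined_AE w by blast
    \<comment> \<open>The common level is at least \<open>2 * n\<close> because
      \<open>determined_add\<close> forms products of two elements of level
      \<open>n\<close>.\<close>
    then obtain N C where NC: "2 * n \<le> N" "determined N C s" "determined N C t"
      using add.IH determined_common[of _ _ s _ _ t "2 * n"] by metis
    have "s ++ t \<in> osums (words F n)" using add.hyps by (intro osums_add)
    then show ?case
      using determined_add[OF _ NC(2) _ NC(3) add.hyps(3) _ NC(1)] add.hyps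
        words_SigmaPow[OF F] osums_words_SigmaPow[OF F] by blast
  qed
  then show ?thesis
    using determined_AE t' SigmaPow_pbij[OF F assms] osums_words_pbij[OF F] by blast
qed

end

end

section \<open>Comparison of generating sets\<close>

text \<open>An element is coded by the set \<open>D\<close> where it leaves the centre and by its
  values there, \<open>None\<close> included. Allowing all subsets for \<open>D\<close> is
  affordable, as \<open>d * ln 2\<close> is negligible against \<open>d * ln d\<close>.\<close>

lemma card_hamming_ball:
  assumes "\<And>\<sigma>. \<sigma> \<in> B \<Longrightarrow> pperm d \<sigma> \<and> card {i. \<sigma> i \<noteq> \<rho> i} \<le> k"
    and \<rho>: "pperm d \<rho>"
  shows "finite B" "card B \<le> 2 ^ d * (d + 1) ^ k"
proof -
  let ?V = "insert None (Some ` {1..d})"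
  let ?D = "{D \<in> Pow {1..d}. card D \<le> k}"
  let ?f = "\<lambda>D f i. if i \<in> D then f i else \<rho> i"
  let ?U = "\<Union>D\<in>?D. ?f D ` (D \<rightarrow>\<^sub>E ?V)"
  have V: "card ?V = d + 1" by (simp add: card_image)
  have fin: "finite (D \<rightarrow>\<^sub>E ?V)" if "D \<in> ?D" for D
    using that finite_subset[of D "{1..d}"] by (intro finite_PiE) auto
  have "B \<subseteq> ?U"
  proof
    fix \<sigma> assume "\<sigma> \<in> B"
    then have \<sigma>: "pperm d \<sigma>" "card {i. \<sigma> i \<noteq> \<rho> i} \<le> k" using assms(1) by auto
    define D where "D = {i. \<sigma> i \<noteq> \<rho> i}"
    have "D \<subseteq> dom \<sigma> \<union> dom \<rho>" by (auto simp: D_def dom_def)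
    then have D: "D \<in> ?D" using \<sigma> \<rho> unfolding pperm_def D_def by blast
    have "\<sigma> i \<in> ?V" for i
      using \<sigma>(1) unfolding pperm_def by (cases "\<sigma> i") (auto simp: ran_def)
    then have "restrict \<sigma> D \<in> D \<rightarrow>\<^sub>E ?V" by auto
    moreover have "\<sigma> = ?f D (restrict \<sigma> D)" by (auto simp: D_def)
    ultimately show "\<sigma> \<in> ?U" using D by blast
  qed
  moreover have finU: "finite ?U" using fin by (intro finite_UN_I finite_imageI) auto
  ultimately show "finite B" using finite_subset by blast
  have "card B \<le> card ?U" using \<open>B \<subseteq> ?U\<close> finU by (intro card_mono)
  also have "\<dots> \<le> (\<Sum>D\<in>?D. card (?f D ` (D \<rightarrow>\<^sub>E ?V)))" by (intro card_UN_le) simp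
  also have "\<dots> \<le> (\<Sum>D\<in>?D. (d + 1) ^ k)"
  proof (intro sum_mono)
    fix D assume D: "D \<in> ?D"
    have "card (?f D ` (D \<rightarrow>\<^sub>E ?V)) \<le> card (D \<rightarrow>\<^sub>E ?V)" using fin[OF D] by (rule card_image_le)
    also have "\<dots> = (d + 1) ^ card D"
      using D finite_subset[of D "{1..d}"] V by (subst card_PiE) auto
    also have "\<dots> \<le> (d + 1) ^ k" using D by (intro power_increasing) auto
    finally show "card (?f D ` (D \<rightarrow>\<^sub>E ?V)) \<le> (d + 1) ^ k" .
  qed
  also have "\<dots> = card ?D * (d + 1) ^ k" by simp
  also have "card ?D \<le> card (Pow {1..d})" by (intro card_mono) auto
  finally show "card B \<le> 2 ^ d * (d + 1) ^ k" by (simp add: card_Pow)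
qed

text \<open>Every partial permutation lies in the Hamming ball of radius \<open>d\<close> about the
  identity.\<close>

lemma finite_pperm: "finite {\<sigma>. pperm d \<sigma>}"
proof (rule card_hamming_ball(1)[where \<rho> = "pid_d d" and d = d and k = d])
  fix \<sigma> assume "\<sigma> \<in> {\<sigma>. pperm d \<sigma>}"
  then have \<sigma>: "pperm d \<sigma>" by simp
  have "{i. \<sigma> i \<noteq> pid_d d i} \<subseteq> {1..d}"
    using \<sigma> by (auto simp: pperm_def pid_d_def dom_def)
  then have "card {i. \<sigma> i \<noteq> pid_d d i} \<le> card {1..d}" by (intro card_mono) auto
  then show "pperm d \<sigma> \<and> card {i. \<sigma> i \<noteq> pid_d d i} \<le> d" using \<sigma> by simp
qed (use pperm_pid_d in auto)

lemma card_le_fibres: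
  assumes "finite X" "finite Y" "g ` X \<subseteq> Y" "\<And>x. x \<in> X \<Longrightarrow> card {x' \<in> X. g x' = g x} \<le> K"
  shows "card X \<le> card Y * K"
proof -
  have "X = (\<Union>y\<in>g ` X. {x \<in> X. g x = y})" by auto
  then have "card X \<le> (\<Sum>y\<in>g ` X. card {x \<in> X. g x = y})"
    using card_UN_le[of "g ` X" "\<lambda>y. {x \<in> X. g x = y}"] assms(1) by simp
  also have "\<dots> \<le> (\<Sum>y\<in>g ` X. K)" using assms(4) by (intro sum_mono) auto
  also have "\<dots> \<le> card Y * K" using assms(2,3) by (simp add: card_mono)
  finally show ?thesis .
qed

text \<open>For \<open>c\<close> strictly between lower and upper limit, the ultrafilter would
  decide on which side of \<open>c\<close> the sequence stays, contradicting one of the two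
  inequalities. So the limit exists in \<open>ereal\<close>, and \<open>Lim\<close> denotes
  it.\<close>

lemma Lim_ultrafilter:
  fixes f :: "nat \<Rightarrow> ereal"
  assumes "nonprincipal_ultrafilter \<omega>"
  shows "Lim \<omega> f = Limsup \<omega> f"
proof -
  have \<omega>: "\<omega> \<noteq> bot" "\<And>P. eventually P \<omega> \<or> eventually (\<lambda>x. \<not> P x) \<omega>"
    using assms by (auto simp: nonprincipal_ultrafilter_def)
  have "Limsup \<omega> f \<le> Liminf \<omega> f"
  proof (rule ccontr)
    assume "\<not> Limsup \<omega> f \<le> Liminf \<omega> f"
    then obtain c where c: "Liminf \<omega> f < c" "c < Limsup \<omega> f"
      unfolding not_le using dense by blast
    from \<omega>(2)[of "\<lambda>x. c \<le> f x"] show False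
    proof
      assume "\<forall>\<^sub>F x in \<omega>. c \<le> f x"
      from Liminf_bounded[OF this] c show False by simp
    next
      assume "\<forall>\<^sub>F x in \<omega>. \<not> c \<le> f x"
      then have "\<forall>\<^sub>F x in \<omega>. f x \<le> c" by eventually_elim simp
      from Limsup_bounded[OF this] c show False by simp
    qed
  qed
  then have "Liminf \<omega> f = Limsup \<omega> f" using Liminf_le_Limsup[OF \<omega>(1), of f] by simp
  then have "(f \<longlongrightarrow> Limsup \<omega> f) \<omega>" using Liminf_eq_Limsup[OF \<omega>(1)] by blast
  then show ?thesis using \<omega>(1) by (intro tendsto_Lim)
qed

section \<open>Transport of microstates between two generating sets\<close>

context pmp_relation
begin

lemma dyn_gen_pbij: "dyn_gen M R F \<Longrightarrow> F \<subseteq> {s. pbij M R s}"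
  by (simp add: dyn_gen_def)

text \<open>The eventual form in the level lets finitely many elements be approximated at one common
  level.\<close>

lemma eventually_approximated:
  assumes "dyn_gen M R E" "pbij M R t" "0 < \<epsilon>"
  shows "\<forall>\<^sub>F n in sequentially. \<exists>s\<in>SigmaPow M R E n. udist M t s < \<epsilon>"
proof -
  obtain n s where "s \<in> SigmaPow M R E n" "udist M t s < \<epsilon>"
    using assms unfolding dyn_gen_def by blast
  then show ?thesis
    unfolding eventually_sequentially using SigmaPow_mono[OF dyn_gen_pbij[OF assms(1)]] by blast
qed

text \<open>A single index serves as level of the approximant, level of the microstates and
  constant. All three conditions persist when it grows, so finitely many elements can again be
  treated together.\<close>

lemma eventually_approximated_determined:
  assumes "dyn_gen M R F" "pbij M R t" "0 < \<epsilon>"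
  shows "\<forall>\<^sub>F n in sequentially. \<exists>s\<in>SigmaPow M R F n. udist M t s < \<epsilon> \<and> determined F n (real n) s"
proof -
  note F = dyn_gen_pbij[OF assms(1)]
  obtain n s where s: "s \<in> SigmaPow M R F n" "udist M t s < \<epsilon>"
    using assms unfolding dyn_gen_def by blast
  obtain N C where NC: "determined F N C s" using determined_SigmaPow[OF F s(1)] by blast
  obtain k where k: "C \<le> real k" using real_arch_simple by blast
  show ?thesis
    unfolding eventually_sequentially
  proof (intro exI allI impI)
    fix n' assume n': "max n (max N k) \<le> n'"
    then have "s \<in> SigmaPow M R F n'" "determined F n' (real n') s"
      using SigmaPow_mono[OF F _ s(1)] determined_mono[OF F NC] k by auto
    then show "\<exists>s\<in>SigmaPow M R F n'. udist M t s < \<epsilon> \<and> determined F n' (real n') s"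
      using s(2) by blast
  qed
qed

text \<open>Composing with \<open>app\<close> must give a microstate again. Hence \<open>app\<close>
  may depend only on the almost everywhere class of its argument, and it must fix
  \<open>pid M\<close> exactly. The bound \<open>1 \<le> m\<close> puts the generators in
  \<open>E\<close> at the level of the approximants.\<close>

lemma approximating_map:
  assumes E: "dyn_gen M R E" and F: "F \<subseteq> {s. pbij M R s}" "finite F" and "0 < \<epsilon>"
  obtains m app where "1 \<le> m" "app (pid M) = pid M"
    "\<And>t. t \<in> SigmaPow M R F N \<Longrightarrow> app t \<in> SigmaPow M R E m \<and> udist M t (app t) < \<epsilon>"
    "\<And>s t. AE x in M. s x = t x \<Longrightarrow> pbij M R s \<Longrightarrow> pbij M R t \<Longrightarrow> app s = app t"
    "\<And>t. pbij M R t \<Longrightarrow> pbij M R (app t)"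
proof -
  note Epb = dyn_gen_pbij[OF E]
  obtain T where T: "finite T" "T \<subseteq> SigmaPow M R F N"
    "\<And>t. t \<in> SigmaPow M R F N \<Longrightarrow> \<exists>u\<in>T. AE x in M. t x = u x"
    using SigmaPow_finite_mod_AE[OF F] by blast
  have Tpb: "pbij M R u" if "u \<in> T" for u using that T(2) SigmaPow_pbij[OF F(1)] by blast
  have "\<forall>\<^sub>F n in sequentially. \<forall>u\<in>T. \<exists>s\<in>SigmaPow M R E n. udist M u s < \<epsilon>"
    using T(1) eventually_approximated[OF E _ \<open>0 < \<epsilon>\<close>] Tpb by (intro eventually_ball_finite) auto
  then have "\<forall>\<^sub>F n in sequentially. 1 \<le> n \<and> (\<forall>u\<in>T. \<exists>s\<in>SigmaPow M R E n. udist M u s < \<epsilon>)"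
    using eventually_ge_at_top[of 1] by eventually_elim simp
  then obtain m where m: "1 \<le> m" "\<forall>u\<in>T. \<exists>s\<in>SigmaPow M R E m. udist M u s < \<epsilon>"
    unfolding eventually_sequentially by blast
  then obtain g where g: "\<And>u. u \<in> T \<Longrightarrow> g u \<in> SigmaPow M R E m \<and> udist M u (g u) < \<epsilon>" by metis
  \<comment> \<open>Almost everywhere equal maps satisfy the same predicate here, so the choice
    returns the same representative for both.\<close>
  define rep where "rep t = (SOME u. u \<in> T \<and> (AE x in M. t x = u x))" for t
  have rep: "rep t \<in> T \<and> (AE x in M. t x = rep t x)" if "t \<in> SigmaPow M R F N" for t
  proof -
    have "\<exists>u. u \<in> T \<and> (AE x in M. t x = u x)" using T(3)[OF that] by blast
    then show ?thesis unfolding rep_def by (rule someI_ex)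
  qed
  \<comment> \<open>The class of the identity is treated separately to get an exact value. Outside
    \<open>SigmaPow M R F N\<close> a microstate meets no product or trace condition, and
    \<open>pid M\<close> serves as default.\<close>
  define app where "app t = (if AE x in M. t x = pid M x then pid M
    else if t \<in> SigmaPow M R F N then g (rep t) else pid M)" for t
  show ?thesis
  proof
    show "1 \<le> m" by fact
    show "app (pid M) = pid M" by (simp add: app_def)
  next
    fix t assume t: "t \<in> SigmaPow M R F N"
    have tpb: "pbij M R t" using SigmaPow_pbij[OF F(1) t] .
    show "app t \<in> SigmaPow M R E m \<and> udist M t (app t) < \<epsilon>"
    proof (cases "AE x in M. t x = pid M x")
      case True
      then show ?thesis
        using SigmaPow_pid[OF Epb] udist_eq_0_iff[OF tpb pbij_pid] \<open>0 < \<epsilon>\<close> by (simp add: app_def)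
    next
      case False
      have r: "rep t \<in> T" "udist M t (rep t) = 0"
        using rep[OF t] udist_eq_0_iff[OF tpb Tpb] by auto
      have "udist M t (g (rep t)) \<le> udist M t (rep t) + udist M (rep t) (g (rep t))"
        using g[OF r(1)] SigmaPow_pbij[OF Epb] Tpb[OF r(1)] tpb by (intro udist_triangle) auto
      then show ?thesis using False t r g[OF r(1)] by (simp add: app_def)
    qed
  next
    fix s t assume st: "AE x in M. s x = t x" "pbij M R s" "pbij M R t"
    have "(AE x in M. s x = u x) \<longleftrightarrow> (AE x in M. t x = u x)" for u
      using AE_eq_trans[OF st(1)] AE_eq_trans[OF AE_eq_sym[OF st(1)]] by blast
    moreover from this have "rep s = rep t" unfolding rep_def by simp
    moreover have "s \<in> SigmaPow M R F N \<longleftrightarrow> t \<in> SigmaPow M R F N"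
      using SigmaPow_AE[OF F(1)] st AE_eq_sym[OF st(1)] by blast
    ultimately show "app s = app t" by (simp add: app_def)
  next
    fix t assume "pbij M R t"
    show "pbij M R (app t)"
      using g rep SigmaPow_pbij[OF Epb] pbij_pid by (auto simp: app_def)
  qed
qed

text \<open>The elements \<open>app (s \<circ>\<^sub>m t)\<close> and
  \<open>app s \<circ>\<^sub>m app t\<close> live at level \<open>2 * m\<close>, and comparing them
  by \<open>SA_continuous\<close> doubles the level again. Their distance is below 3\<epsilon>;
  continuity turns this into 6\<epsilon> + 20\<delta>, and the product rule adds one more
  \<delta>.\<close>

lemma SA_transport:
  assumes E: "E \<subseteq> {s. pbij M R s}" and F: "F \<subseteq> {s. pbij M R s}"
    and app: "app (pid M) = pid M"
    "\<And>t. t \<in> SigmaPow M R F N \<Longrightarrow> app t \<in> SigmaPow M R E m \<and> udist M t (app t) < \<epsilon>"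
    "\<And>s t. AE x in M. s x = t x \<Longrightarrow> pbij M R s \<Longrightarrow> pbij M R t \<Longrightarrow> app s = app t"
    "\<And>t. pbij M R t \<Longrightarrow> pbij M R (app t)"
    and \<phi>: "\<phi> \<in> SA M R E (4 * m) \<delta> d" and d: "0 < d"
    and \<delta>': "6 * \<epsilon> + 21 * \<delta> \<le> \<delta>'" "0 < \<epsilon>" "0 < \<delta>"
  shows "(\<lambda>t. if pbij M R t then \<phi> (app t) else Map.empty) \<in> SA M R F N \<delta>' d"
proof -
  let ?\<psi> = "\<lambda>t. if pbij M R t then \<phi> (app t) else Map.empty"
  have pp: "pperm d (\<phi> (app t))" if "pbij M R t" for t
    using SA_pperm[OF E \<phi> d app(4)[OF that]] .
  have mult: "udist_d d (?\<psi> (s \<circ>\<^sub>m t)) (?\<psi> s \<circ>\<^sub>m ?\<psi> t) < \<delta>'"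
    if st: "s \<in> SigmaPow M R F N" "t \<in> SigmaPow M R F N" "s \<circ>\<^sub>m t \<in> SigmaPow M R F N" for s t
  proof -
    have pb: "pbij M R s" "pbij M R t" "pbij M R (s \<circ>\<^sub>m t)" using st SigmaPow_pbij[OF F] by blast+
    note apb = pb[THEN app(4)] and ap = st[THEN app(2)]
    let ?u = "app (s \<circ>\<^sub>m t)" and ?v = "app s \<circ>\<^sub>m app t"
    have uv: "?u \<in> SigmaPow M R E (2 * m)" "?v \<in> SigmaPow M R E (2 * m)"
      using ap SigmaPow_mono_double[OF E, of m "2 * m"] SigmaPow_comp_double[OF E, of m "2 * m"] by auto
    have mem: "app s \<in> SigmaPow M R E (4 * m)" "app t \<in> SigmaPow M R E (4 * m)" "?v \<in> SigmaPow M R E (4 * m)"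
      using ap uv SigmaPow_mono[OF E, of m "4 * m"] SigmaPow_mono[OF E, of "2 * m" "4 * m"] by auto
    have "udist M ?u ?v \<le> udist M ?u (s \<circ>\<^sub>m t) + udist M (s \<circ>\<^sub>m t) ?v"
      using apb pb by (intro udist_triangle pbij_comp)
    also have "udist M (s \<circ>\<^sub>m t) ?v \<le> udist M s (app s) + udist M t (app t)"
      using apb pb by (intro udist_comp)
    finally have "udist M ?u ?v < 3 * \<epsilon>" using ap by (simp add: udist_sym)
    then have lt: "2 * udist M ?u ?v + 21 * \<delta> < \<delta>'" using \<delta>' by simp
    have fin: "finite (dom (\<phi> ?u))" "finite (dom (\<phi> ?v))" "finite (dom (\<phi> (app s) \<circ>\<^sub>m \<phi> (app t)))"
      using SA_finite[OF E \<phi> d] apb pbij_comp finite_dom_comp by blast+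
    have "real (card {i. \<phi> ?u i \<noteq> (\<phi> (app s) \<circ>\<^sub>m \<phi> (app t)) i}) \<le> (2 * udist M ?u ?v + 21 * \<delta>) * d"
      using card_differ_triangle[OF fin] SA_mult[OF E \<phi> d mem] SA_continuous[OF E \<phi> d _ uv]
      by (simp add: algebra_simps)
    also have "\<dots> < \<delta>' * d" using lt d by simp
    finally have "real (card {i. \<phi> ?u i \<noteq> (\<phi> (app s) \<circ>\<^sub>m \<phi> (app t)) i}) / d < \<delta>'"
      using d by (simp add: pos_divide_less_eq)
    moreover have "dom (\<phi> (app s) \<circ>\<^sub>m \<phi> (app t)) \<subseteq> dom (\<phi> (app t))"
      by (auto simp: map_comp_Some_iff)
    then have "udist_d d (\<phi> ?u) (\<phi> (app s) \<circ>\<^sub>m \<phi> (app t)) =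
        real (card {i. \<phi> ?u i \<noteq> (\<phi> (app s) \<circ>\<^sub>m \<phi> (app t)) i}) / d"
      using pp pb unfolding pperm_def by (intro udist_d_eq) blast+
    ultimately show ?thesis using pb by simp
  qed
  have tr: "\<bar>tr_d d (?\<psi> s) - trace M s\<bar> < \<delta>'" if s: "s \<in> SigmaPow M R F N" for s
  proof -
    have pb: "pbij M R s" using SigmaPow_pbij[OF F s] .
    have "app s \<in> SigmaPow M R E (4 * m)"
      using app(2)[OF s] SigmaPow_mono[OF E, of m "4 * m"] by auto
    then have "\<bar>tr_d d (\<phi> (app s)) - trace M (app s)\<bar> < \<delta>"
      using \<phi> by (simp add: SA_def)
    moreover have "\<bar>trace M s - trace M (app s)\<bar> < \<epsilon>"
      using trace_diff_le_udist[OF pb app(4)[OF pb]] app(2)[OF s] by simp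
    ultimately have "\<bar>tr_d d (\<phi> (app s)) - trace M s\<bar> < \<delta>'" using \<delta>' by linarith
    then show ?thesis using pb by simp
  qed
  have one: "?\<psi> (pid M) = pid_d d"
    using \<phi> pbij_pid app(1) by (simp add: SA_def)
  have "?\<psi> s = ?\<psi> t" if "pbij M R s \<and> pbij M R t \<and> (AE x in M. s x = t x)" for s t
    using that app(3)[of s t] by simp
  then show ?thesis
    unfolding SA_def mem_Collect_eq using mult tr one pp by (intro conjI allI impI ballI) auto
qed

text \<open>For a generator \<open>e\<close> with approximant \<open>h e\<close>, the value
  \<open>\<phi> e\<close> is close to \<open>\<phi> (app (h e))\<close>. The latter is
  \<open>\<Psi> \<phi>\<close> at \<open>h e\<close>, which is nearly determined by
  \<open>\<Psi> \<phi>\<close> on \<open>F\<close>. Passing from \<open>e\<close> to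
  \<open>app (h e)\<close> costs 3\<eta>/8 in each microstate, and the comparison at
  \<open>h e\<close> costs \<eta>/4.\<close>

lemma SA_comparison:
  fixes \<delta>\<^sub>0 \<eta> :: real
  assumes E: "dyn_gen M R E" "finite E" and F: "dyn_gen M R F" "finite F"
    and pos: "0 < \<delta>\<^sub>0" "0 < \<eta>"
  obtains n \<delta> \<Psi> where "0 < \<delta>"
    "\<forall>d>0. \<forall>\<phi>\<in>SA M R E n \<delta> d. \<Psi> \<phi> \<in> SA M R F n\<^sub>0 \<delta>\<^sub>0 d"
    "\<forall>d>0. \<forall>\<phi>\<in>SA M R E n \<delta> d. \<forall>\<phi>'\<in>SA M R E n \<delta> d. (\<forall>f\<in>F. \<Psi> \<phi> f = \<Psi> \<phi>' f) \<longrightarrow>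
      (\<forall>e\<in>E. real (card {i. \<phi> e i \<noteq> \<phi>' e i}) \<le> \<eta> * d)"
proof -
  note Epb = dyn_gen_pbij[OF E(1)] and Fpb = dyn_gen_pbij[OF F(1)]
  have "\<forall>\<^sub>F n in sequentially. \<forall>e\<in>E. \<exists>s\<in>SigmaPow M R F n. udist M e s < \<eta> / 16 \<and> determined F n (real n) s"
  proof (intro eventually_ball_finite ballI)
    fix e assume "e \<in> E"
    then have "pbij M R e" "0 < \<eta> / 16" using Epb pos by auto
    then show "\<forall>\<^sub>F n in sequentially. \<exists>s\<in>SigmaPow M R F n. udist M e s < \<eta> / 16 \<and> determined F n (real n) s"
      by (rule eventually_approximated_determined[OF F(1)])
  qed (rule E(2))
  then have "\<forall>\<^sub>F n in sequentially. n\<^sub>0 \<le> n \<and> (\<forall>e\<in>E. \<exists>s\<in>SigmaPow M R F n. udist M e s < \<eta> / 16 \<and> determined F n (real n) s)"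
    using eventually_ge_at_top[of n\<^sub>0] by eventually_elim simp
  then obtain N where N: "n\<^sub>0 \<le> N"
    "\<forall>e\<in>E. \<exists>s\<in>SigmaPow M R F N. udist M e s < \<eta> / 16 \<and> determined F N (real N) s"
    unfolding eventually_sequentially by blast
  then obtain h where h: "\<And>e. e \<in> E \<Longrightarrow> h e \<in> SigmaPow M R F N \<and> udist M e (h e) < \<eta> / 16 \<and> determined F N (real N) (h e)"
    by metis
  \<comment> \<open>As \<open>h e\<close> is determined with constant \<open>N\<close>, this
    tolerance keeps the error at \<open>h e\<close> within \<eta>/4. The summand 1 covers
    \<open>N = 0\<close>.\<close>
  define \<delta>\<^sub>1 where "\<delta>\<^sub>1 = min \<delta>\<^sub>0 (\<eta> / (4 * (real N + 1)))"
  have \<delta>\<^sub>1: "0 < \<delta>\<^sub>1" "\<delta>\<^sub>1 \<le> \<delta>\<^sub>0" using pos by (auto simp: \<delta>\<^sub>1_def)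
  have "real N * \<delta>\<^sub>1 \<le> (real N + 1) * (\<eta> / (4 * (real N + 1)))"
    using pos by (intro mult_mono) (auto simp: \<delta>\<^sub>1_def)
  also have "\<dots> = \<eta> / 4" by (simp add: divide_simps)
  finally have N\<delta>: "real N * \<delta>\<^sub>1 \<le> \<eta> / 4" .
  \<comment> \<open>Half of \<open>\<delta>\<^sub>1\<close> is reserved for 6\<epsilon> and half for
    21\<delta>. The second entries keep 2(\<eta>/16 + \<epsilon>) + 20\<delta> within
    3\<eta>/8.\<close>
  define \<epsilon> where "\<epsilon> = min (\<delta>\<^sub>1 / 12) (\<eta> / 16)"
  define \<delta> where "\<delta> = min (\<delta>\<^sub>1 / 42) (\<eta> / 160)"
  have \<epsilon>: "0 < \<epsilon>" "\<epsilon> \<le> \<eta> / 16" and \<delta>: "0 < \<delta>" "\<delta> \<le> \<eta> / 160" and sum: "6 * \<epsilon> + 21 * \<delta> \<le> \<delta>\<^sub>1"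
    using \<delta>\<^sub>1 pos by (auto simp: \<epsilon>_def \<delta>_def)
  obtain m app where m: "1 \<le> m" and app: "app (pid M) = pid M"
    "\<And>t. t \<in> SigmaPow M R F N \<Longrightarrow> app t \<in> SigmaPow M R E m \<and> udist M t (app t) < \<epsilon>"
    "\<And>s t. AE x in M. s x = t x \<Longrightarrow> pbij M R s \<Longrightarrow> pbij M R t \<Longrightarrow> app s = app t"
    "\<And>t. pbij M R t \<Longrightarrow> pbij M R (app t)"
    using approximating_map[OF E(1) Fpb F(2) \<epsilon>(1), of N] by blast
  define \<Psi> where "\<Psi> \<phi> = (\<lambda>t. if pbij M R t then \<phi> (app t) else Map.empty)"
    for \<phi> :: "('a \<rightharpoonup> 'a) \<Rightarrow> nat \<rightharpoonup> nat"
  have \<Psi>: "\<Psi> \<phi> \<in> SA M R F N \<delta>\<^sub>1 d" if "0 < d" "\<phi> \<in> SA M R E (4 * m) \<delta> d" for \<phi> d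
    unfolding \<Psi>_def using SA_transport[OF Epb Fpb app that(2,1) sum \<epsilon>(1) \<delta>(1)] .
  show ?thesis
  proof
    show "0 < \<delta>" by (rule \<delta>)
    show "\<forall>d>0. \<forall>\<phi>\<in>SA M R E (4 * m) \<delta> d. \<Psi> \<phi> \<in> SA M R F n\<^sub>0 \<delta>\<^sub>0 d"
      using \<Psi> SA_mono[OF Fpb N(1) \<delta>\<^sub>1(2)] by blast
  next
    show "\<forall>d>0. \<forall>\<phi>\<in>SA M R E (4 * m) \<delta> d. \<forall>\<phi>'\<in>SA M R E (4 * m) \<delta> d.
      (\<forall>f\<in>F. \<Psi> \<phi> f = \<Psi> \<phi>' f) \<longrightarrow> (\<forall>e\<in>E. real (card {i. \<phi> e i \<noteq> \<phi>' e i}) \<le> \<eta> * d)"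
    proof (intro allI impI ballI)
      fix \<phi> \<phi>' :: "('a \<rightharpoonup> 'a) \<Rightarrow> nat \<rightharpoonup> nat" and d e
      assume d: "0 < d" and \<phi>: "\<phi> \<in> SA M R E (4 * m) \<delta> d" and \<phi>': "\<phi>' \<in> SA M R E (4 * m) \<delta> d"
        and eq: "\<forall>f\<in>F. \<Psi> \<phi> f = \<Psi> \<phi>' f" and e: "e \<in> E"
      have hpb: "pbij M R (h e)" using h[OF e] SigmaPow_pbij[OF Fpb] by blast
      have epb: "pbij M R e" using e Epb by blast
      have ah: "app (h e) \<in> SigmaPow M R E m" "udist M (h e) (app (h e)) < \<epsilon>"
        using app(2) h[OF e] by auto
      have em: "e \<in> SigmaPow M R E m"
        using subset_SigmaPow_one[OF Epb] SigmaPow_mono[OF Epb m] e by blast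
      have m4: "2 * m \<le> 4 * m" by simp
      have "udist M e (app (h e)) \<le> udist M e (h e) + udist M (h e) (app (h e))"
        using epb hpb app(4)[OF hpb] by (intro udist_triangle)
      also have "\<dots> \<le> \<eta> / 8" using h[OF e] ah(2) \<epsilon>(2) by linarith
      finally have "2 * udist M e (app (h e)) + 20 * \<delta> \<le> 3 * \<eta> / 8" using \<delta>(2) by simp
      then have "(2 * udist M e (app (h e)) + 20 * \<delta>) * d \<le> 3 * \<eta> / 8 * d"
        by (rule mult_right_mono) simp
      then have near: "real (card {i. \<theta> e i \<noteq> \<theta> (app (h e)) i}) \<le> 3 * \<eta> / 8 * d"
        if "\<theta> \<in> SA M R E (4 * m) \<delta> d" for \<theta>
        using SA_continuous[OF Epb that d m4 em ah(1)] by linarith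
      have "determined F N (real N) (h e)" using h[OF e] by blast
      then have "real (card {i. \<Psi> \<phi> (h e) i \<noteq> \<Psi> \<phi>' (h e) i}) \<le> real N * \<delta>\<^sub>1 * d"
        using \<Psi>[OF d \<phi>] \<Psi>[OF d \<phi>'] \<delta>\<^sub>1(1) d eq unfolding determined_def[OF Fpb] by blast
      also have "\<dots> \<le> \<eta> / 4 * d" using N\<delta> by (rule mult_right_mono) simp
      finally have "real (card {i. \<phi> (app (h e)) i \<noteq> \<phi>' (app (h e)) i}) \<le> \<eta> / 4 * d"
        using hpb by (simp add: \<Psi>_def)
      moreover note near[OF \<phi>] near[OF \<phi>']
      moreover note fin = SA_finite[OF Epb \<phi> d epb] SA_finite[OF Epb \<phi> d app(4)[OF hpb]]
        SA_finite[OF Epb \<phi>' d app(4)[OF hpb]] SA_finite[OF Epb \<phi>' d epb]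
      moreover note card_differ_triangle[OF fin(1,2,4)] card_differ_triangle[OF fin(2,3,4)]
        card_differ_sym[of "\<phi>' e" "\<phi>' (app (h e))"]
      ultimately show "real (card {i. \<phi> e i \<noteq> \<phi>' e i}) \<le> \<eta> * d"
        by (simp add: algebra_simps)
    qed
  qed
qed

section \<open>Counting restrictions and comparing entropies\<close>

lemma finite_SA_restrict:
  assumes F: "F \<subseteq> {s. pbij M R s}" "finite F"
  shows "finite ((\<lambda>\<phi>. restrict \<phi> F) ` SA M R F n \<delta> d)"
proof (rule finite_subset)
  show "(\<lambda>\<phi>. restrict \<phi> F) ` SA M R F n \<delta> d \<subseteq> F \<rightarrow>\<^sub>E {\<sigma>. pperm d \<sigma>}"
    using F unfolding SA_def by (auto simp: PiE_iff)
  show "finite (F \<rightarrow>\<^sub>E {\<sigma>. pperm d \<sigma>})"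
    using F finite_pperm by (intro finite_PiE)
qed

text \<open>\<Psi> induces a map from restrictions to \<open>E\<close> to restrictions to
  \<open>F\<close>. Each of its fibres lies in a product, over \<open>E\<close>, of Hamming balls of
  radius \<open>k\<close> around any one of its members.\<close>

lemma NSA_le:
  assumes E: "E \<subseteq> {s. pbij M R s}" "finite E" and F: "F \<subseteq> {s. pbij M R s}" "finite F"
    and d: "0 < d"
    and \<Psi>: "\<And>\<phi>. \<phi> \<in> SA M R E n \<delta> d \<Longrightarrow> \<Psi> \<phi> \<in> SA M R F n' \<delta>' d"
    and near: "\<And>\<phi> \<phi>' e. \<phi> \<in> SA M R E n \<delta> d \<Longrightarrow> \<phi>' \<in> SA M R E n \<delta> d \<Longrightarrow>
      \<forall>f\<in>F. \<Psi> \<phi> f = \<Psi> \<phi>' f \<Longrightarrow> e \<in> E \<Longrightarrow> card {i. \<phi> e i \<noteq> \<phi>' e i} \<le> k"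
  shows "NSA M R E n \<delta> d \<le> NSA M R F n' \<delta>' d * (2 ^ d * (d + 1) ^ k) ^ card E"
proof -
  define X where "X = (\<lambda>\<phi>. restrict \<phi> E) ` SA M R E n \<delta> d"
  \<comment> \<open>\<open>\<Psi> \<phi>\<close> may depend on values of \<phi> outside
    \<open>E\<close>, so one microstate is chosen for each restriction before \<Psi> is
    applied.\<close>
  define lift where "lift = inv_into (SA M R E n \<delta> d) (\<lambda>\<phi>. restrict \<phi> E)"
  have lift: "lift x \<in> SA M R E n \<delta> d" "restrict (lift x) E = x" if "x \<in> X" for x
    using that inv_into_into[of x "\<lambda>\<phi>. restrict \<phi> E" "SA M R E n \<delta> d"]
      f_inv_into_f[of x "\<lambda>\<phi>. restrict \<phi> E" "SA M R E n \<delta> d"]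
    unfolding X_def lift_def by blast+
  have lift_app: "x e = lift x e" if "x \<in> X" "e \<in> E" for x e
    using lift(2)[OF that(1)] that(2) by (metis restrict_apply')
  have "card X \<le> card ((\<lambda>\<phi>. restrict \<phi> F) ` SA M R F n' \<delta>' d) * (2 ^ d * (d + 1) ^ k) ^ card E"
  proof (rule card_le_fibres)
    show "finite X" unfolding X_def using finite_SA_restrict[OF E] .
    show "finite ((\<lambda>\<phi>. restrict \<phi> F) ` SA M R F n' \<delta>' d)" using finite_SA_restrict[OF F] .
    show "(\<lambda>x. restrict (\<Psi> (lift x)) F) ` X \<subseteq> (\<lambda>\<phi>. restrict \<phi> F) ` SA M R F n' \<delta>' d"
      using \<Psi> lift by blast
  next
    fix x assume x: "x \<in> X"
    let ?B = "\<lambda>e. {\<sigma>. pperm d \<sigma> \<and> card {i. \<sigma> i \<noteq> x e i} \<le> k}"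
    have pp: "pperm d (x e)" if "x \<in> X" "e \<in> E" for x e
      using SA_pperm[OF E(1) lift(1)[OF that(1)] d] lift_app[OF that] that(2) E(1) by auto
    have B: "finite (?B e)" "card (?B e) \<le> 2 ^ d * (d + 1) ^ k" if "e \<in> E" for e
      using card_hamming_ball[OF _ pp[OF x that], of "?B e" k] by auto
    have "{x' \<in> X. restrict (\<Psi> (lift x')) F = restrict (\<Psi> (lift x)) F} \<subseteq> PiE E ?B"
    proof
      fix x' assume "x' \<in> {x' \<in> X. restrict (\<Psi> (lift x')) F = restrict (\<Psi> (lift x)) F}"
      then have x': "x' \<in> X" and eq: "restrict (\<Psi> (lift x')) F = restrict (\<Psi> (lift x)) F" by auto
      have "\<forall>f\<in>F. \<Psi> (lift x') f = \<Psi> (lift x) f"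
        using eq by (metis restrict_apply')
      then have "x' e \<in> ?B e" if "e \<in> E" for e
        using near[OF lift(1)[OF x'] lift(1)[OF x] _ that] pp[OF x' that] lift_app x x' that by simp
      moreover have "x' \<in> extensional E" using lift(2)[OF x'] by (metis restrict_extensional)
      ultimately show "x' \<in> PiE E ?B" by (auto simp: PiE_iff)
    qed
    then have "card {x' \<in> X. restrict (\<Psi> (lift x')) F = restrict (\<Psi> (lift x)) F} \<le> card (PiE E ?B)"
      using E(2) B(1) by (intro card_mono finite_PiE)
    also have "\<dots> = (\<Prod>e\<in>E. card (?B e))" using E(2) by (rule card_PiE)
    also have "\<dots> \<le> (\<Prod>e\<in>E. 2 ^ d * (d + 1) ^ k)" using B(2) by (intro prod_mono) auto
    also have "\<dots> = (2 ^ d * (d + 1) ^ k) ^ card E" by simp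
    finally show "card {x' \<in> X. restrict (\<Psi> (lift x')) F = restrict (\<Psi> (lift x)) F} \<le> (2 ^ d * (d + 1) ^ k) ^ card E" .
  qed
  then show ?thesis by (simp add: NSA_def X_def)
qed

lemma ent_seq_comparison:
  fixes \<delta>\<^sub>0 \<kappa> :: real
  assumes E: "dyn_gen M R E" "finite E" and F: "dyn_gen M R F" "finite F"
    and pos: "0 < \<delta>\<^sub>0" "0 < \<kappa>"
  obtains n \<delta> where "0 < \<delta>"
    "\<forall>\<^sub>F d in sequentially. ent_seq M R E n \<delta> d \<le> ent_seq M R F n\<^sub>0 \<delta>\<^sub>0 d + ereal \<kappa>"
proof -
  define c where "c = real (card E)"
  \<comment> \<open>Eventually each generator in \<open>E\<close> costs less than 2\<eta> after
    normalisation, so \<open>c\<close> of them cost at most \<kappa>. The \<open>c + 1\<close>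
    covers an empty \<open>E\<close>.\<close>
  define \<eta> where "\<eta> = \<kappa> / (2 * (c + 1))"
  have c: "0 \<le> c" by (simp add: c_def)
  then have \<eta>: "0 < \<eta>" using pos by (simp add: \<eta>_def)
  obtain n \<delta> \<Psi> where \<delta>: "0 < \<delta>"
    and \<Psi>: "\<forall>d>0. \<forall>\<phi>\<in>SA M R E n \<delta> d. \<Psi> \<phi> \<in> SA M R F n\<^sub>0 \<delta>\<^sub>0 d"
    and near: "\<forall>d>0. \<forall>\<phi>\<in>SA M R E n \<delta> d. \<forall>\<phi>'\<in>SA M R E n \<delta> d. (\<forall>f\<in>F. \<Psi> \<phi> f = \<Psi> \<phi>' f) \<longrightarrow>
      (\<forall>e\<in>E. real (card {i. \<phi> e i \<noteq> \<phi>' e i}) \<le> \<eta> * d)"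
    by (rule SA_comparison[OF E F pos(1) \<eta>, where n\<^sub>0 = n\<^sub>0]) (rule that)
  have "((\<lambda>d::nat. (real d * ln 2 + \<eta> * real d * ln (real d + 1)) / (real d * ln (real d))) \<longlongrightarrow> \<eta>) sequentially"
    using \<eta> by real_asymp
  then have "\<forall>\<^sub>F d in sequentially. (real d * ln 2 + \<eta> * real d * ln (real d + 1)) / (real d * ln (real d)) < 2 * \<eta>"
    using \<eta> by (intro order_tendstoD(2)) auto
  then have "\<forall>\<^sub>F d in sequentially. ent_seq M R E n \<delta> d \<le> ent_seq M R F n\<^sub>0 \<delta>\<^sub>0 d + ereal \<kappa>"
    \<comment> \<open>From \<open>d = 2\<close> on, \<open>d * ln d\<close> is positive and may be
      divided by.\<close>
    using eventually_ge_at_top[of 2]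
  proof eventually_elim
    case (elim d)
    define k where "k = nat \<lfloor>\<eta> * d\<rfloor>"
    have k: "real k \<le> \<eta> * d" using \<eta> by (simp add: k_def)
    have d: "0 < d" "0 < real d * ln (real d)" using elim by auto
    have *: "NSA M R E n \<delta> d \<le> NSA M R F n\<^sub>0 \<delta>\<^sub>0 d * (2 ^ d * (d + 1) ^ k) ^ card E"
    proof (rule NSA_le[where \<Psi> = \<Psi>])
      fix \<phi> \<phi>' e assume "\<phi> \<in> SA M R E n \<delta> d" "\<phi>' \<in> SA M R E n \<delta> d"
        "\<forall>f\<in>F. \<Psi> \<phi> f = \<Psi> \<phi>' f" "e \<in> E"
      then have "real (card {i. \<phi> e i \<noteq> \<phi>' e i}) \<le> \<eta> * d" using near d(1) by blast
      then show "card {i. \<phi> e i \<noteq> \<phi>' e i} \<le> k" unfolding k_def by (simp add: le_nat_floor)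
    qed (use E F d \<Psi> dyn_gen_pbij in auto)
    show ?case
    proof (cases "NSA M R E n \<delta> d = 0")
      case True
      then show ?thesis by (simp add: ent_seq_def)
    next
      case False
      let ?a = "real (NSA M R E n \<delta> d)" and ?b = "real (NSA M R F n\<^sub>0 \<delta>\<^sub>0 d)"
      \<comment> \<open>A vanishing count for \<open>F\<close> would force one for \<open>E\<close>,
        so the value -\<infinity> cannot occur on the right alone.\<close>
      have nz: "NSA M R F n\<^sub>0 \<delta>\<^sub>0 d \<noteq> 0" using False * by (metis le_zero_eq mult_zero_left)
      have "?a \<le> real (NSA M R F n\<^sub>0 \<delta>\<^sub>0 d * (2 ^ d * (d + 1) ^ k) ^ card E)"
        using * by (simp only: of_nat_le_iff)
      also have "\<dots> = ?b * (2 ^ d * (real d + 1) ^ k) ^ card E" by (simp add: add.commute)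
      finally have "ln ?a \<le> ln (?b * (2 ^ d * (real d + 1) ^ k) ^ card E)"
        using False by (subst ln_le_cancel_iff) (auto simp: nz)
      also have "\<dots> = ln ?b + c * (real d * ln 2 + real k * ln (real d + 1))"
        using nz by (simp add: ln_mult ln_realpow c_def)
      also have "\<dots> \<le> ln ?b + c * (real d * ln 2 + \<eta> * real d * ln (real d + 1))"
        using c k by (intro add_left_mono mult_left_mono mult_right_mono) auto
      finally have "ln ?a / (d * ln d) \<le> (ln ?b + c * (real d * ln 2 + \<eta> * real d * ln (real d + 1))) / (d * ln d)"
        using d(2) by (intro divide_right_mono) auto
      also have "\<dots> = ln ?b / (d * ln d) + c * ((real d * ln 2 + \<eta> * real d * ln (real d + 1)) / (d * ln d))"
        by (subst add_divide_distrib) (simp only: times_divide_eq_right)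
      also have "c * ((real d * ln 2 + \<eta> * real d * ln (real d + 1)) / (d * ln d)) \<le> c * (2 * \<eta>)"
        using elim c by (intro mult_left_mono) auto
      also have "c * (2 * \<eta>) \<le> \<kappa>" using c pos by (simp add: \<eta>_def field_simps)
      finally show ?thesis using False nz by (simp add: ent_seq_def)
    qed
  qed
  with \<delta> show ?thesis using that by blast
qed

text \<open>A general filter below \<open>sequentially\<close> treats all three entropies at once:
  \<open>sequentially\<close> itself gives the upper and lower limits, and an ultrafilter gives the
  third, its \<open>Lim\<close> being a \<open>Limsup\<close>. The loss \<kappa> disappears because
  it is arbitrary, while the left side is an infimum over all \<open>n\<close> and \<delta>.\<close>

lemma INF_Limsup_ent_seq_le:
  assumes EF: "dyn_gen M R E" "finite E" "dyn_gen M R F" "finite F"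
    and G: "G \<noteq> bot" "G \<le> sequentially"
  shows "(INF n. INF \<delta>\<in>{0<..}. Limsup G (ent_seq M R E n \<delta>))
    \<le> (INF n. INF \<delta>\<in>{0<..}. Limsup G (ent_seq M R F n \<delta>))" (is "?I \<le> _")
    and "(INF n. INF \<delta>\<in>{0<..}. Liminf G (ent_seq M R E n \<delta>))
    \<le> (INF n. INF \<delta>\<in>{0<..}. Liminf G (ent_seq M R F n \<delta>))" (is "?J \<le> _")
proof -
  have "?I \<le> Limsup G (ent_seq M R F n\<^sub>0 \<delta>\<^sub>0) \<and> ?J \<le> Liminf G (ent_seq M R F n\<^sub>0 \<delta>\<^sub>0)"
    if \<delta>\<^sub>0: "0 < \<delta>\<^sub>0" for n\<^sub>0 \<delta>\<^sub>0
  proof (rule conjI; rule ereal_le_epsilon2)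
    fix \<kappa> :: real assume \<kappa>: "0 < \<kappa>"
    obtain n \<delta> where \<delta>: "0 < \<delta>"
      and ev: "\<forall>\<^sub>F d in sequentially. ent_seq M R E n \<delta> d \<le> ent_seq M R F n\<^sub>0 \<delta>\<^sub>0 d + ereal \<kappa>"
      using ent_seq_comparison[OF EF \<delta>\<^sub>0 \<kappa>, of n\<^sub>0] by blast
    have ev: "\<forall>\<^sub>F d in G. ent_seq M R E n \<delta> d \<le> ent_seq M R F n\<^sub>0 \<delta>\<^sub>0 d + ereal \<kappa>"
      using ev G(2) by (rule filter_leD[rotated])
    have "?I \<le> Limsup G (ent_seq M R E n \<delta>)"
      using \<delta> by (intro INF_lower2[of n] INF_lower) auto
    also have "\<dots> \<le> Limsup G (\<lambda>d. ent_seq M R F n\<^sub>0 \<delta>\<^sub>0 d + ereal \<kappa>)" using ev by (rule Limsup_mono)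
    also have "\<dots> = Limsup G (ent_seq M R F n\<^sub>0 \<delta>\<^sub>0) + ereal \<kappa>"
      using G(1) by (intro Limsup_add_ereal_right) auto
    finally show "?I \<le> Limsup G (ent_seq M R F n\<^sub>0 \<delta>\<^sub>0) + ereal \<kappa>" .
    have "?J \<le> Liminf G (ent_seq M R E n \<delta>)"
      using \<delta> by (intro INF_lower2[of n] INF_lower) auto
    also have "\<dots> \<le> Liminf G (\<lambda>d. ent_seq M R F n\<^sub>0 \<delta>\<^sub>0 d + ereal \<kappa>)" using ev by (rule Liminf_mono)
    also have "\<dots> = Liminf G (ent_seq M R F n\<^sub>0 \<delta>\<^sub>0) + ereal \<kappa>"
      using G(1) by (intro Liminf_add_ereal_right) auto
    finally show "?J \<le> Liminf G (ent_seq M R F n\<^sub>0 \<delta>\<^sub>0) + ereal \<kappa>" .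
  qed
  then show "?I \<le> (INF n. INF \<delta>\<in>{0<..}. Limsup G (ent_seq M R F n \<delta>))"
    "?J \<le> (INF n. INF \<delta>\<in>{0<..}. Liminf G (ent_seq M R F n \<delta>))"
    by (auto intro!: INF_greatest)
qed

end

theorem theorem1p1:
  fixes M :: "'a::polish_space measure" and R :: "('a \<times> 'a) set"
    and E F :: "('a \<rightharpoonup> 'a) set"
  assumes "prob_space M" and "sets M = sets borel"
    and "cber M R" and "pmp_rel M R"
    and "finite E" and "finite F"
    and "dyn_gen M R E" and "dyn_gen M R F"
  shows "s_ent M R E = s_ent M R F \<and> s_ent_low M R E = s_ent_low M R F \<and>
    (\<forall>\<omega>. nonprincipal_ultrafilter \<omega> \<longrightarrow> s_ent_omega \<omega> M R E = s_ent_omega \<omega> M R F)"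
proof -
  have "space M = UNIV" using sets_eq_imp_space_eq[OF assms(2)] by simp
  then have "pmp_relation M R"
    using assms(1-4) by (simp add: pmp_relation_def pmp_relation_axioms_def cber_def)
  then interpret pmp_relation M R .
  \<comment> \<open>The comparison is one-sided; exchanging \<open>E\<close> and \<open>F\<close>
    supplies the reverse inequalities.\<close>
  note le = INF_Limsup_ent_seq_le[OF assms(7,5,8,6)] INF_Limsup_ent_seq_le[OF assms(8,6,7,5)]
  have "s_ent M R E = s_ent M R F"
    unfolding s_ent_def using le(1,3)[of sequentially] by (intro antisym) auto
  moreover have "s_ent_low M R E = s_ent_low M R F"
    unfolding s_ent_low_def using le(2,4)[of sequentially] by (intro antisym) auto
  moreover have "s_ent_omega \<omega> M R E = s_ent_omega \<omega> M R F" if \<omega>: "nonprincipal_ultrafilter \<omega>" for \<omega>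
  proof -
    \<comment> \<open>On \<open>nat\<close> the cofinite filter is \<open>sequentially\<close>, so
      nonprincipality is the required refinement.\<close>
    have "\<omega> \<noteq> bot" "\<omega> \<le> sequentially"
      using \<omega> by (auto simp: nonprincipal_ultrafilter_def cofinite_eq_sequentially)
    then show ?thesis
      unfolding s_ent_omega_def Lim_ultrafilter[OF \<omega>] using le(1,3)[of \<omega>] by (intro antisym)
  qed
  ultimately show ?thesis by blast
qed

end
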